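(* Let $m\ge 5$, $1<r<m-1$, $\gcd(r,m)=1$. There are exactly three equivalence classes of Niho bent functions on $K=\mathbb{F}_{2^{2m}}$ associated with the translation hyperoval $\mathcal{D}(t^{2^r})$. Their representatives are the functions $f_r(x)$, $f_{m-r}(x)$ and $$f(x)=tr\Big(\langle i,x\rangle^{(1-2^r)^{-1}}\langle 1,x\rangle^{q-(1-2^r)^{-1}}\Big),$$ where $(1-2^r)^{-1}$ is the inverse of $1-2^r$ modulo $q-1$. The corresponding $g$-function representatives are $g_r(u)$, $g_{m-r}(u)$ and $$g(u)=\langle i,u\rangle^{(1-2^r)^{-1}}\langle 1,u\rangle^{q-(1-2^r)^{-1}}.$$
   Context: $F=\mathbb{F}_{q}$ with $q=2^m$, $n=2m$, $K=\mathbb{F}_{2^n}\supset F$, $\bar{x}=x^q$, $\langle x,y\rangle=x\bar y+\bar xy\in F$, $S=\{u\in K: u\bar u=1\}$; $tr$ is the trace from $F$ to $\mathbb{F}_2$ and $Tr$ is the trace from $K$ to $\mathbb{F}_2$. Every $x\in K^*$ is uniquely $x=\lambda u$ with $\lambda\in F^*$, $u\in S$. Fix $i\in K$ with $i+\bar i=1$. The residue $(1-2^r)^{-1}$ is represented by an integer in $\{1,\dots,q-2\}$. Two models of $PG(2,q)$ are used: (i) homogeneous triples $(x:y:z)$ over $F$; (ii) pairs $(x:z)$, $x\in K$, $z\in F$, not both zero, up to $F^*$. They are identified by $(x:y:z)\leftrightarrow(x+yi:z)$. In model (ii) the affine points $(x:1)$ are identified with $x\in K$, and the points at infinity are $u_\infty=(u:0)$,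 $u\in S$. The origin is $0\in K$. For $g:S\to F$, if $g(u)=0$ then $u/g(u)$ denotes $u_\infty$. An oval (resp. hyperoval) in $PG(2,q)$ is a set of $q+1$ (resp. $q+2$) points, no three collinear; the tangents of an oval meet in one point, its nucleus. Projective equivalence is equivalence under $P\Gamma L(3,q)$. For $h:F\to F$, $\mathcal{D}(h)=\{(t:h(t):1)\mid t\in F\}\cup\{(1:0:0),(0:1:0)\}$. A Boolean function $f:K\to\mathbb{F}_2$ is bent if $\sum_{x\in K}(-1)^{f(x)+Tr(b\bar x)}=\pm 2^m$ for all $b\in K$. A Niho bent function is a bent function of the form $f(\lambda u)=tr(\lambda g(u))$, $\lambda\in F$, $u\in S$, for some $g:S\to F$; $g$ is called its $g$-function. It is known that such an $f$ is bent if and only if $\{u/g(u)\mid u\in S\}$ is an oval with nucleus the origin. A Niho bent function with $g$-function $g$ is associated with a hyperoval $\mathcal{H}$ if $\{u/g(u)\mid u\in S\}\cup\{0\}$ is projectively equivalent to $\mathcal{H}$. Boolean functions $f,f'$ on $K$ are equivalent if $f'=f\circ L+\ell$ for some $\mathbb{F}_2$-affine permutation $L$ of $K$ and some $\mathbb{F}_2$-affine function $\ell:K\to\mathbb{F}_2$; equivalence classes are taken with respect to this relation. Fix $a\in K$ with $a+\bar a=1$. For $1<r<m$ with $\gcd(r,m)=1$ put $$f_r(x)=Tr\Big(ax^{2^m+1}+\sum_{j=1}^{2^{r-1}-1}x^{d_j}\Big),\qquad 2^rd_j\equiv(2^m-1)j+2^r \pmod{2^n-1},$$ $$g_r(u)=\frac{u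 u^{2^{m-r}}+\bar u\bar u^{2^{m-r}}}{u^{2^{m-r}}+\bar u^{2^{m-r}}}\ (u\in S,\,u\neq 1),\qquad g_r(1)=1.$$ *)

theory Defs
  imports
    "HOL-Analysis.Determinants"
    "HOL-Library.Z2"
    "HOL-Number_Theory.Cong"
begin

text \<open>
  The field K is a finite field type of cardinality \<open>2 ^ (2 * m)\<close> (this is a hypothesis of the
  theorem), and F is its subfield of order \<open>2 ^ m\<close>.  All definitions carry the
  parameter \<open>m\<close>.  The field with two elements is the type \<^typ>\<open>bit\<close>.
\<close>

section \<open>The fields\<close>

definition subF :: "nat \<Rightarrow> 'a::field set" where
  "subF m = {x. x ^ (2 ^ m) = x}"

definition bar :: "nat \<Rightarrow> 'a::field \<Rightarrow> 'a" where
  "bar m x = x ^ (2 ^ m)"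

definition form :: "nat \<Rightarrow> 'a::field \<Rightarrow> 'a \<Rightarrow> 'a" where
  "form m x y = x * bar m y + bar m x * y"

definition unitS :: "nat \<Rightarrow> 'a::field set" where
  "unitS m = {u. u * bar m u = 1}"

text \<open>Identifies the prime field \<open>{0, 1}\<close> of K, in which traces take their values, with
  \<^typ>\<open>bit\<close>.\<close>

definition to_bit :: "'a::field \<Rightarrow> bit" where
  "to_bit x = (if x = 0 then 0 else 1)"

text \<open>The trace from F to the prime field; only meaningful for arguments in F.\<close>

definition trF :: "nat \<Rightarrow> 'a::field \<Rightarrow> bit" where
  "trF m x = to_bit (\<Sum>k<m. x ^ (2 ^ k))"

definition trK :: "nat \<Rightarrow> 'a::field \<Rightarrow> bit" where
  "trK m x = to_bit (\<Sum>k<2 * m. x ^ (2 ^ k))"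


section \<open>Two models of the projective plane over F\<close>

definition pointT :: "nat \<Rightarrow> 'a::field ^ 3 \<Rightarrow> ('a ^ 3) set" where
  "pointT m v = {c *s v | c. c \<in> subF m \<and> c \<noteq> 0}"

definition PG2 :: "nat \<Rightarrow> ('a::field ^ 3) set set" where
  "PG2 m = {pointT m v | v. (\<forall>k. v $ k \<in> subF m) \<and> v \<noteq> 0}"

definition pointP :: "nat \<Rightarrow> 'a::field \<Rightarrow> 'a \<Rightarrow> ('a \<times> 'a) set" where
  "pointP m x z = {(c * x, c * z) | c. c \<in> subF m \<and> c \<noteq> 0}"

text \<open>The identification of \<open>(x:y:z)\<close> with \<open>(x + y i : z)\<close>, on representatives; a point of the
  triple model is sent to a point of the pair model by taking images.  For a set \<open>X\<close> of points of
  the pair model, \<open>to_triples m i X\<close> is the same set seen in the triple model.\<close>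

definition triple_to_pair :: "'a::field \<Rightarrow> 'a ^ 3 \<Rightarrow> 'a \<times> 'a" where
  "triple_to_pair i v = (v $ 1 + v $ 2 * i, v $ 3)"

definition to_triples :: "nat \<Rightarrow> 'a::field \<Rightarrow> ('a \<times> 'a) set set \<Rightarrow> ('a ^ 3) set set" where
  "to_triples m i X = {P \<in> PG2 m. triple_to_pair i ` P \<in> X}"

definition automorphismF :: "nat \<Rightarrow> ('a::field \<Rightarrow> 'a) \<Rightarrow> bool" where
  "automorphismF m \<sigma> \<longleftrightarrow> bij_betw \<sigma> (subF m) (subF m) \<and>
     (\<forall>x\<in>subF m. \<forall>y\<in>subF m. \<sigma> (x + y) = \<sigma> x + \<sigma> y \<and> \<sigma> (x * y) = \<sigma> x * \<sigma> y)"

definition semilinear_map :: "'a::field ^ 3 ^ 3 \<Rightarrow> ('a \<Rightarrow> 'a) \<Rightarrow> 'a ^ 3 \<Rightarrow> 'a ^ 3" where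
  "semilinear_map A \<sigma> v = A *v (\<chi> k. \<sigma> (v $ k))"

text \<open>Equivalence of sets of points under \<open>P\<Gamma>L(3,q)\<close>.\<close>

definition proj_equivalent :: "nat \<Rightarrow> ('a::field ^ 3) set set \<Rightarrow> ('a ^ 3) set set \<Rightarrow> bool" where
  "proj_equivalent m X Y \<longleftrightarrow> X \<subseteq> PG2 m \<and> Y \<subseteq> PG2 m \<and>
     (\<exists>A \<sigma>. (\<forall>k l. A $ k $ l \<in> subF m) \<and> det A \<noteq> 0 \<and> automorphismF m \<sigma> \<and>
        (\<lambda>P. semilinear_map A \<sigma> ` P) ` X = Y)"

definition D_set :: "nat \<Rightarrow> ('a::field \<Rightarrow> 'a) \<Rightarrow> ('a ^ 3) set set" where
  "D_set m h = {pointT m (vector [t, h t, 1]) | t. t \<in> subF m} \<union>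
     {pointT m (vector [1, 0, 0]), pointT m (vector [0, 1, 0])}"


section \<open>Niho bent functions\<close>

definition sign_bit :: "bit \<Rightarrow> int" where
  "sign_bit b = (if b = 0 then 1 else - 1)"

definition bent :: "nat \<Rightarrow> ('a::{field,finite} \<Rightarrow> bit) \<Rightarrow> bool" where
  "bent m f \<longleftrightarrow>
     (\<forall>b. (\<Sum>x\<in>UNIV. sign_bit (f x + trK m (b * bar m x))) \<in> {2 ^ m, - (2 ^ m)})"

definition is_g_function :: "nat \<Rightarrow> ('a::field \<Rightarrow> 'a) \<Rightarrow> ('a \<Rightarrow> bit) \<Rightarrow> bool" where
  "is_g_function m g f \<longleftrightarrow> (\<forall>u\<in>unitS m. g u \<in> subF m) \<and>
     (\<forall>c\<in>subF m. \<forall>u\<in>unitS m. f (c * u) = trF m (c * g u))"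

text \<open>The point \<open>u / g(u)\<close>, with the convention that it is \<open>u\<^sub>\<infinity> = (u:0)\<close> if \<open>g(u) = 0\<close>.\<close>

definition quot_point :: "nat \<Rightarrow> 'a::field \<Rightarrow> 'a \<Rightarrow> ('a \<times> 'a) set" where
  "quot_point m u c = (if c = 0 then pointP m u 0 else pointP m (u / c) 1)"

definition niho_hyperoval :: "nat \<Rightarrow> ('a::field \<Rightarrow> 'a) \<Rightarrow> ('a \<times> 'a) set set" where
  "niho_hyperoval m g = {quot_point m u (g u) | u. u \<in> unitS m} \<union> {pointP m 0 1}"

definition niho_bent_assoc ::
    "nat \<Rightarrow> 'a::{field,finite} \<Rightarrow> ('a ^ 3) set set \<Rightarrow> ('a \<Rightarrow> bit) set" where
  "niho_bent_assoc m i H =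
     {f. bent m f \<and>
         (\<exists>g. is_g_function m g f \<and> proj_equivalent m (to_triples m i (niho_hyperoval m g)) H)}"

text \<open>A map between vector spaces over the field with two elements is linear iff it is additive.\<close>

definition affine2 :: "('a::ab_group_add \<Rightarrow> 'b::ab_group_add) \<Rightarrow> bool" where
  "affine2 L \<longleftrightarrow> (\<exists>A c. Modules.additive A \<and> L = (\<lambda>x. A x + c))"

definition bool_equiv :: "('a::field \<Rightarrow> bit) \<Rightarrow> ('a \<Rightarrow> bit) \<Rightarrow> bool" where
  "bool_equiv f f' \<longleftrightarrow>
     (\<exists>L l. bij L \<and> affine2 L \<and> affine2 l \<and> f' = (\<lambda>x. f (L x) + l x))"

definition bool_equiv_on :: "('a::field \<Rightarrow> bit) set \<Rightarrow> (('a \<Rightarrow> bit) \<times> ('a \<Rightarrow> bit)) set" where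
  "bool_equiv_on N = {(f, f'). f \<in> N \<and> f' \<in> N \<and> bool_equiv f f'}"


section \<open>The representatives\<close>

text \<open>The exponents \<open>d\<^sub>j\<close> are taken as least residues; they are never \<open>0\<close>.\<close>

definition niho_exp :: "nat \<Rightarrow> nat \<Rightarrow> nat \<Rightarrow> nat" where
  "niho_exp m r j = (THE d. d < 2 ^ (2 * m) - 1 \<and>
     [2 ^ r * d = (2 ^ m - 1) * j + 2 ^ r] (mod (2 ^ (2 * m) - 1)))"

definition f_niho :: "nat \<Rightarrow> 'a::field \<Rightarrow> nat \<Rightarrow> 'a \<Rightarrow> bit" where
  "f_niho m a r x =
     trK m (a * x ^ (2 ^ m + 1) + (\<Sum>j = 1..2 ^ (r - 1) - 1. x ^ niho_exp m r j))"

definition g_niho :: "nat \<Rightarrow> nat \<Rightarrow> 'a::field \<Rightarrow> 'a" where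
  "g_niho m r u =
     (if u = 1 then 1
      else (u * u ^ (2 ^ (m - r)) + bar m u * bar m u ^ (2 ^ (m - r)))
           / (u ^ (2 ^ (m - r)) + bar m u ^ (2 ^ (m - r))))"

definition inv_exp :: "nat \<Rightarrow> nat \<Rightarrow> nat" where
  "inv_exp m r = (THE e. 1 \<le> e \<and> e \<le> 2 ^ m - 2 \<and>
     [(1 - 2 ^ r) * int e = 1] (mod (2 ^ m - 1)))"

definition g_third :: "nat \<Rightarrow> 'a::field \<Rightarrow> nat \<Rightarrow> 'a \<Rightarrow> 'a" where
  "g_third m i r u =
     form m i u ^ inv_exp m r * form m 1 u ^ (2 ^ m - inv_exp m r)"

definition f_third :: "nat \<Rightarrow> 'a::field \<Rightarrow> nat \<Rightarrow> 'a \<Rightarrow> bit" where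
  "f_third m i r x =
     trF m (form m i x ^ inv_exp m r * form m 1 x ^ (2 ^ m - inv_exp m r))"

end

theory Submission
  imports Defs "HOL-Computational_Algebra.Polynomial"
begin

text \<open>
  In the coordinates \<open>x = X + Y i\<close> a Niho function is \<open>f(x) = tr(G(x))\<close> with \<open>G\<close> homogeneous of
  degree one over F, and its hyperoval consists of the points \<open>(X:Y:G(x))\<close> and the nucleus
  \<open>(0:0:1)\<close>.  A semilinear map from this hyperoval to \<open>D(t\<^sup>R)\<close>, \<open>R = 2\<^sup>r\<close>, sends the nucleus either to
  \<open>(1:0:0)\<close>, to \<open>(0:1:0)\<close>, or to an affine point, which a translation moves to the origin.  In each
  case solving the equation \<open>x\<^sup>R = y z\<^sup>R\<^sup>-\<^sup>1\<close> for the coordinate of the nucleus shows that \<open>f\<close> is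
  equivalent to \<open>tr(X\<^sup>k Y\<^sup>q\<^sup>-\<^sup>k)\<close> with \<open>k = 2\<^sup>m\<^sup>-\<^sup>r\<close>, \<open>k = 2\<^sup>r\<close> or \<open>k = (1 - 2\<^sup>r)\<^sup>-\<^sup>1\<close>.

  Up to an additive function, \<open>f\<^sub>r\<close> and \<open>f\<^sub>m\<^sub>-\<^sub>r\<close> are the first two of these (sum the geometric progression
  in \<open>u\<^sup>2\<close> arising from the Niho exponents), and the third one is \<open>f\<close>.  They are pairwise
  inequivalent because their algebraic degrees are \<open>r + 1\<close>, \<open>m - r + 1\<close> and \<open>m\<close>.
\<close>

section \<open>Arithmetic and affine equivalence\<close>

text \<open>For the exponents in question the degree of tr(X^k Y^(q-k)) counts the binary ones of
  the residues of k and q-k modulo q-1 together. For k = 2^j the counts are 1 and m-j. For the third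
  exponent e, choose s with r s = 1 mod m: then e is congruent to minus the sum of 2^(r t) over t <
  s, and q-e to 2^r times that sum, so the counts are m-s and s. Only the lower bound m is needed
  for this function: 1 < r < m-1 keeps the other two degrees below m, and gcd(r,m) = 1 excludes r =
  m-r.

  Degrees are measured by iterated derivatives. An affine substitution only changes the directions
  of differentiation, so invariance is immediate and no basis of K over the prime field has to be
  chosen.

  A semilinear map of the plane need not be linear over F. This does no harm: the trace is invariant
  under automorphisms of F, and the map induced on K is still additive, which is all that
  equivalence of Boolean functions asks for.\<close>

lemma coprime_two_power_minus_one:
  assumes "coprime r m" "0 < r"
  shows "coprime (2 ^ r - 1 :: nat) (2 ^ m - 1)"
proof (rule coprimeI)
  fix c :: nat
  assume c: "c dvd 2 ^ r - 1" "c dvd 2 ^ m - 1"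
  have c1: "[2 ^ r = 1] (mod c)" and c2: "[2 ^ m = 1] (mod c)"
    using c by (simp_all add: cong_altdef_nat)
  \<comment> \<open>Modulo a common divisor c both \<open>2 ^ r\<close> and \<open>2 ^ m\<close> are
    1, so this Bezout identity forces 2 = 1 modulo c.\<close>
  obtain x y where xy: "r * x = m * y + 1"
    using bezout_nat[of r m] assms by (auto simp: coprime_iff_gcd_eq_1)
  have "[(2 ^ r) ^ x = 1 ^ x] (mod c)" "[(2 ^ m) ^ y * 2 = 1 ^ y * 2] (mod c)"
    by (rule cong_pow[OF c1]) (intro cong_mult cong_refl cong_pow[OF c2])
  hence "[2 ^ (r * x) = 1] (mod c)" "[2 ^ (m * y + 1) = 2] (mod c)"
    by (simp_all add: power_mult mult.commute)
  hence "[2 = 1] (mod c)" unfolding xy by (metis cong_sym cong_trans)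
  thus "c dvd 1" by (simp add: cong_altdef_nat)
qed

text \<open>Multiplication by x permutes the nonzero elements, so their product absorbs one factor x
  for each of them.\<close>

lemma finite_field_power_card:
  fixes x :: "'a::{field,finite}"
  shows "x ^ CARD('a) = x"
proof (cases "x = 0")
  case False
  have "(\<Prod>y\<in>UNIV - {0}. x * y) = (\<Prod>y\<in>UNIV - {0}. y)"
    by (rule prod.reindex_bij_witness[of _ "\<lambda>y. y / x" "\<lambda>y. x * y"]) (use False in auto)
  hence "x ^ (CARD('a) - 1) * \<Prod>(UNIV - {0::'a}) = \<Prod>(UNIV - {0::'a})"
    by (simp add: prod.distrib)
  hence "x ^ (CARD('a) - 1) = 1" by simp
  hence "x * x ^ (CARD('a) - 1) = x" by simp
  thus ?thesis by (simp flip: power_Suc)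
qed (simp add: zero_power)

lemma power_swap: "(x ^ a) ^ b = (x ^ b) ^ (a::nat)" for x :: "'a::monoid_mult"
  by (metis power_mult mult.commute)

lemma to_bit_simps [simp]: "to_bit (0::'a::field) = 0" "to_bit (1::'a::field) = 1"
  by (simp_all add: to_bit_def)

lemma sign_bit_add: "sign_bit (a + b) = sign_bit a * sign_bit b"
  by (cases a; cases b) (simp_all add: sign_bit_def)

section \<open>Equivalence of Boolean functions\<close>

lemma affine2I: "(\<And>x y. f (x + y) = f x + f y) \<Longrightarrow> affine2 f"
  unfolding affine2_def by (intro exI[of _ f] exI[of _ 0]) (simp add: Modules.additive_def)

lemma bool_equiv_refl: "bool_equiv f f"
  unfolding bool_equiv_def
proof (intro exI conjI)
  show "bij (\<lambda>x::'a. x)" by (simp add: bij_def inj_def)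
  show "affine2 (\<lambda>x::'a. x)" "affine2 (\<lambda>x::'a. 0 :: bit)" by (rule affine2I, simp)+
  show "f = (\<lambda>x. f x + 0)" by (simp only: add_0_right)
qed

lemma affine2_compose: "affine2 f \<Longrightarrow> affine2 g \<Longrightarrow> affine2 (\<lambda>x. f (g x))"
proof -
  assume "affine2 f" "affine2 g"
  then obtain A c B d where A: "Modules.additive A" "f = (\<lambda>x. A x + c)"
    and B: "Modules.additive B" "g = (\<lambda>x. B x + d)" by (auto simp: affine2_def)
  show ?thesis unfolding affine2_def
    by (intro exI[of _ "\<lambda>x. A (B x)"] exI[of _ "A d + c"])
       (simp add: A(2) B(2) Modules.additive_def additive.add[OF A(1)] additive.add[OF B(1)] ac_simps)
qed

lemma affine2_add: "affine2 f \<Longrightarrow> affine2 g \<Longrightarrow> affine2 (\<lambda>x. f x + g x)"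
proof -
  assume "affine2 f" "affine2 g"
  then obtain A c B d where A: "Modules.additive A" "f = (\<lambda>x. A x + c)"
    and B: "Modules.additive B" "g = (\<lambda>x. B x + d)" by (auto simp: affine2_def)
  show ?thesis unfolding affine2_def
    by (intro exI[of _ "\<lambda>x. A x + B x"] exI[of _ "c + d"])
       (simp add: A(2) B(2) Modules.additive_def additive.add[OF A(1)] additive.add[OF B(1)] ac_simps)
qed

lemma affine2_inv:
  fixes L :: "'a::ab_group_add \<Rightarrow> 'a"
  assumes "affine2 L" "bij L" shows "affine2 (inv L)"
proof -
  obtain A c where A: "Modules.additive A" and L: "\<And>x. L x = A x + c"
    using assms(1) by (auto simp: affine2_def)
  have *: "L (inv L x) = x" "inv L (L x) = x" for x
    using assms(2) by (simp_all add: bij_is_surj surj_f_inv_f bij_is_inj inv_f_f)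
  have A_inv: "A (inv L x) = x - c" for x using *(1)[of x] by (simp add: L eq_diff_eq)
  have "inv L (x + y) - inv L 0 = (inv L x - inv L 0) + (inv L y - inv L 0)" (is "?l = ?r") for x y
  proof -
    have "L (?r + inv L 0) = L (?l + inv L 0)"
      by (simp add: L additive.add[OF A] additive.diff[OF A] A_inv)
    hence "?r + inv L 0 = ?l + inv L 0" using assms(2) by (metis *(2))
    thus ?thesis by simp
  qed
  thus ?thesis unfolding affine2_def
    by (intro exI[of _ "\<lambda>x. inv L x - inv L 0"] exI[of _ "inv L 0"]) (simp add: Modules.additive_def)
qed

lemma bool_equiv_sym: assumes "bool_equiv f f'" shows "bool_equiv f' f"
proof -
  obtain L l where L: "bij L" "affine2 L" "affine2 l" "f' = (\<lambda>x. f (L x) + l x)"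
    using assms by (auto simp: bool_equiv_def)
  have "f = (\<lambda>x. f' (inv L x) + l (inv L x))"
  proof
    fix x
    have "L (inv L x) = x" using L(1) by (simp add: bij_is_surj surj_f_inv_f)
    thus "f x = f' (inv L x) + l (inv L x)" unfolding L(4) by (cases "l (inv L x)") simp_all
  qed
  thus ?thesis unfolding bool_equiv_def
    using L bij_imp_bij_inv affine2_inv affine2_compose by blast
qed

lemma bool_equiv_trans: assumes "bool_equiv f f'" "bool_equiv f' f''" shows "bool_equiv f f''"
proof -
  obtain L l where L: "bij L" "affine2 L" "affine2 l" "f' = (\<lambda>x. f (L x) + l x)"
    using assms(1) by (auto simp: bool_equiv_def)
  obtain M k where M: "bij M" "affine2 M" "affine2 k" "f'' = (\<lambda>x. f' (M x) + k x)"
    using assms(2) by (auto simp: bool_equiv_def)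
  show ?thesis unfolding bool_equiv_def
  proof (intro exI conjI)
    show "bij (\<lambda>x. L (M x))" using bij_comp[OF M(1) L(1)] by (simp add: comp_def)
    show "affine2 (\<lambda>x. L (M x))" by (rule affine2_compose[OF L(2) M(2)])
    show "affine2 (\<lambda>x. l (M x) + k x)" by (rule affine2_add[OF affine2_compose[OF L(3) M(2)] M(3)])
    show "f'' = (\<lambda>x. f (L (M x)) + (l (M x) + k x))" by (simp only: L(4) M(4) add.assoc)
  qed
qed

section \<open>Niho functions over a quadratic extension\<close>

locale niho_field =
  fixes m :: nat and i :: "'a::{field,finite}"
  assumes card_K: "CARD('a) = 2 ^ (2 * m)" and m_pos: "0 < m" and i_bar: "i + bar m i = 1"
begin

abbreviation F :: "'a set" where "F \<equiv> subF m"
abbreviation q :: nat where "q \<equiv> 2 ^ m"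
abbreviation conj :: "'a \<Rightarrow> 'a" where "conj \<equiv> bar m"

lemma q_gt_1: "1 < q" using m_pos by (intro one_less_power) auto

lemma q_minus: "q = Suc (q - 1)" "0 < q - 1" using q_gt_1 by simp_all

text \<open>Translation by 1 permutes K, so the copies of 1, one for each element, add up to 0;
  their number is a power of two.\<close>

lemma two_eq_0: "(2::'a) = 0"
proof -
  have "(\<Sum>y\<in>UNIV. y + 1 :: 'a) = (\<Sum>y\<in>UNIV. y)"
    by (rule sum.reindex_bij_witness[of _ "\<lambda>y. y - 1" "\<lambda>y. y + 1"]) auto
  hence "of_nat (CARD('a)) = (0::'a)" by (simp add: sum.distrib)
  thus ?thesis by (simp add: card_K)
qed

lemma add_self [simp]: "x + x = (0::'a)"
  using two_eq_0 by (metis mult_2 mult_zero_left)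

lemma add_self_left [simp]: "x + (x + y) = (y::'a)"
  by (simp flip: add.assoc)

lemma uminus_eq [simp]: "- x = (x::'a)"
  using add_self by (rule minus_unique)

lemma minus_eq [simp]: "x - y = x + (y::'a)"
  by (simp add: diff_conv_add_uminus del: add_uminus_conv_diff)

lemma add_eq_0_iff [simp]: "x + y = 0 \<longleftrightarrow> x = (y::'a)"
  by (metis add_self add_left_cancel)

lemma add_pow: "(x + y :: 'a) ^ (2 ^ k) = x ^ (2 ^ k) + y ^ (2 ^ k)"
proof (induction k arbitrary: x y)
  case (Suc k)
  have sq: "(x + y) ^ 2 = x ^ 2 + (y::'a) ^ 2" for x y
    by (simp add: power2_sum two_eq_0)
  show ?case by (simp only: power_Suc power_mult sq Suc)
qed simp

lemma sum_pow: "(\<Sum>x\<in>A. f x :: 'a) ^ (2 ^ k) = (\<Sum>x\<in>A. f x ^ (2 ^ k))"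
  by (induction A rule: infinite_finite_induct) (auto simp: add_pow power_0_left)

lemma inj_pow2: "x ^ (2 ^ k) = y ^ (2 ^ k) \<longleftrightarrow> x = (y::'a)"
proof
  assume "x ^ (2 ^ k) = y ^ (2 ^ k)"
  hence "(x + y) ^ (2 ^ k) = 0" by (simp add: add_pow)
  thus "x = y" by simp
qed simp

lemma pow_card: "x ^ (2 ^ (2 * m)) = (x::'a)"
  using finite_field_power_card[of x] by (simp add: card_K)

lemma conj_conj [simp]: "conj (conj x) = x"
  using pow_card[of x] by (simp add: bar_def power_add mult_2 flip: power_mult)

lemma conj_add: "conj (x + y) = conj x + conj y" by (simp add: bar_def add_pow)
lemma conj_mult: "conj (x * y) = conj x * conj y" by (simp add: bar_def power_mult_distrib)
lemma conj_power: "conj (x ^ n) = conj x ^ n" unfolding bar_def by (rule power_swap)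
lemma conj_0 [simp]: "conj 0 = 0" by (simp add: bar_def)
lemma conj_1 [simp]: "conj 1 = 1" by (simp add: bar_def)
lemma conj_eq_0 [simp]: "conj x = 0 \<longleftrightarrow> x = 0" by (simp add: bar_def)

lemma mem_F_iff: "x \<in> F \<longleftrightarrow> conj x = x" by (simp add: subF_def bar_def)
lemma F_pow_q: "x \<in> F \<Longrightarrow> x ^ q = x" by (simp add: subF_def)

lemma F_zero [simp, intro]: "0 \<in> F" and F_one [simp, intro]: "1 \<in> F"
  by (simp_all add: mem_F_iff)

lemma F_add [simp, intro]: "x \<in> F \<Longrightarrow> y \<in> F \<Longrightarrow> x + y \<in> F"
  by (simp add: mem_F_iff conj_add)

lemma F_mult [simp, intro]: "x \<in> F \<Longrightarrow> y \<in> F \<Longrightarrow> x * y \<in> F"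
  by (simp add: mem_F_iff conj_mult)

lemma F_power [simp, intro]: "x \<in> F \<Longrightarrow> x ^ n \<in> F"
  by (simp add: mem_F_iff conj_power)

lemma F_inverse [simp, intro]: "x \<in> F \<Longrightarrow> inverse x \<in> F"
  by (simp only: subF_def mem_Collect_eq power_inverse)

lemma F_divide [simp, intro]: "x \<in> F \<Longrightarrow> y \<in> F \<Longrightarrow> x / y \<in> F"
  unfolding divide_inverse by (intro F_mult F_inverse)

lemma F_sum: "(\<And>x. x \<in> A \<Longrightarrow> f x \<in> F) \<Longrightarrow> sum f A \<in> F"
  by (induction A rule: infinite_finite_induct) auto

lemma F_pow_minus_one:
  assumes "x \<in> F" "x \<noteq> 0" shows "x ^ (q - 1) = 1"
proof -
  have "x * x ^ (q - 1) = x * 1" using F_pow_q[OF assms(1)] by (simp flip: power_Suc)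
  thus ?thesis using assms(2) mult_left_cancel by blast
qed

text \<open>Positive exponents keep the reduction modulo q - 1 valid at x = 0.\<close>

lemma F_pow_cong:
  assumes "x \<in> F" "[a = b] (mod q - 1)" "0 < a" "0 < b"
  shows "x ^ a = x ^ b"
proof (cases "x = 0")
  case False
  have *: "x ^ n = x ^ (n mod (q - 1))" for n
  proof -
    have "x ^ n = x ^ ((q - 1) * (n div (q - 1)) + n mod (q - 1))" by (simp only: mult_div_mod_eq)
    thus ?thesis by (simp only: power_add power_mult F_pow_minus_one[OF assms(1) False] power_one mult_1)
  qed
  show ?thesis using *[of a] *[of b] assms(2) by (simp only: cong_def)
qed (use assms(3,4) in \<open>simp add: zero_power\<close>)

text \<open>The form is alternating and takes the value 1 on the pair 1, i. Pairing x = X + Y i with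
  i and with 1 therefore reads off X and Y.\<close>

definition cX :: "'a \<Rightarrow> 'a" where "cX x = form m i x"
definition cY :: "'a \<Rightarrow> 'a" where "cY x = form m 1 x"

lemma conj_i: "conj i = i + 1"
  using i_bar by (metis add_self_left)

lemma cY_eq: "cY x = x + conj x" by (simp add: cY_def form_def add.commute)
lemma cX_eq: "cX x = i * conj x + (i + 1) * x" by (simp add: cX_def form_def conj_i)

lemma form_in_F [simp]: "form m x y \<in> F"
  by (simp add: mem_F_iff form_def conj_add conj_mult ac_simps)

lemma form_add: "form m (b::'a) (x + y) = form m b x + form m b y"
  by (simp add: form_def conj_add algebra_simps)

lemma form_add_left: "form m (x + y) (b::'a) = form m x b + form m y b"
  by (simp add: form_def conj_add algebra_simps)

lemma form_scale: "c \<in> F \<Longrightarrow> form m b (c * x) = c * form m b x"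
  by (simp add: form_def conj_mult mem_F_iff algebra_simps)

lemma cX_F [simp]: "cX x \<in> F" and cY_F [simp]: "cY x \<in> F" by (simp_all add: cX_def cY_def)

lemma coords: "cX x + cY x * i = x"
proof -
  have "cX x + cY x * i = (i * conj x + i * conj x) + (i * x + i * x) + x"
    unfolding cX_eq cY_eq by (simp add: algebra_simps)
  thus ?thesis by (simp only: add_self add_0)
qed

lemma conj_F: "x \<in> F \<Longrightarrow> conj x = x" by (simp add: mem_F_iff)

lemma cY_coords: "X \<in> F \<Longrightarrow> Y \<in> F \<Longrightarrow> cY (X + Y * i) = Y"
  by (simp add: cY_eq conj_add conj_mult conj_F conj_i algebra_simps)

lemma cX_coords: assumes "X \<in> F" "Y \<in> F" shows "cX (X + Y * i) = X"
proof -
  have "cX (X + Y * i) + cY (X + Y * i) * i = X + Y * i" by (rule coords)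
  thus ?thesis by (simp add: cY_coords assms)
qed

lemma cX_add: "cX (x + y) = cX x + cX y" and cY_add: "cY (x + y) = cY x + cY y"
  by (simp_all add: cX_def cY_def form_add)

lemma cX_scale: "c \<in> F \<Longrightarrow> cX (c * x) = c * cX x" and cY_scale: "c \<in> F \<Longrightarrow> cY (c * x) = c * cY x"
  by (simp_all add: cX_def cY_def form_scale)

lemma cXY_eq_0: "cX x = 0 \<and> cY x = 0 \<longleftrightarrow> x = 0"
  using coords[of x] cX_coords[of 0 0] cY_coords[of 0 0] by auto

lemma sum_coords: "(\<Sum>x\<in>UNIV. h (cX x) (cY x)) = (\<Sum>X\<in>F. \<Sum>Y\<in>F. h X Y)"
  unfolding sum.cartesian_product
  by (rule sum.reindex_bij_witness[of _ "\<lambda>(X, Y). X + Y * i" "\<lambda>x. (cX x, cY x)"])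
     (auto simp: coords cX_coords cY_coords)

text \<open>Coordinates identify K with F x F, so the square of \<open>card F\<close> is the square
  of q.\<close>

lemma card_F: "card F = q"
proof -
  have "CARD('a) = card (F \<times> F)"
    using sum_coords[of "\<lambda>_ _. 1::nat"] by (simp add: card_cartesian_product)
  hence "(card F) ^ 2 = q ^ 2"
    by (simp add: card_K card_cartesian_product power2_eq_square mult_2 power_add)
  thus ?thesis by simp
qed

text \<open>Otherwise the nonzero polynomial x^(2^j) + x of degree at most 2^j < q would have q
  roots.\<close>

lemma pow2_fixed_imp:
  assumes "j < m" "\<And>y. y \<in> F \<Longrightarrow> y ^ (2 ^ j) = y"
  shows "j = 0"
proof (rule ccontr)
  assume "j \<noteq> 0"
  define p :: "'a poly" where "p = monom 1 (2 ^ j) + monom 1 1"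
  have j: "1 < (2::nat) ^ j" using \<open>j \<noteq> 0\<close> by (intro one_less_power) auto
  have "coeff p (2 ^ j) = 1" using j by (simp add: p_def)
  hence "p \<noteq> 0" by auto
  have "degree p \<le> 2 ^ j"
    unfolding p_def using j by (intro degree_add_le order.trans[OF degree_monom_le]) auto
  have "F \<subseteq> {x. poly p x = 0}" using assms(2) by (auto simp: p_def poly_monom)
  hence "card F \<le> card {x. poly p x = 0}" by (intro card_mono) auto
  also have "\<dots> \<le> 2 ^ j" using card_poly_roots_bound[OF \<open>p \<noteq> 0\<close>] \<open>degree p \<le> 2 ^ j\<close> by linarith
  finally show False using assms(1) by (simp add: card_F)
qed

text \<open>Replacing x by g x permutes F and multiplies the sum by \<open>g ^ k\<close>.\<close>

lemma power_sum_0: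
  assumes "g \<in> F" "g \<noteq> 0" "g ^ k \<noteq> 1"
  shows "(\<Sum>x\<in>F. x ^ k) = 0"
proof -
  have "(\<Sum>x\<in>F. x ^ k) = (\<Sum>x\<in>F. (g * x) ^ k)"
    by (rule sum.reindex_bij_witness[of _ "\<lambda>y. g * y" "\<lambda>y. y / g"]) (use assms in auto)
  also have "\<dots> = g ^ k * (\<Sum>x\<in>F. x ^ k)" by (simp add: power_mult_distrib sum_distrib_left)
  finally have "(g ^ k - 1) * (\<Sum>x\<in>F. x ^ k) = 0" by (simp add: algebra_simps)
  thus ?thesis using assms(3) by simp
qed

text \<open>The nonzero elements contribute q - 1 ones, an odd number, and a positive k removes the
  term at 0.\<close>

lemma power_sum_1:
  assumes "\<And>x. x \<in> F \<Longrightarrow> x \<noteq> 0 \<Longrightarrow> x ^ k = 1" "0 < k"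
  shows "(\<Sum>x\<in>F. x ^ k) = 1"
proof -
  have "(\<Sum>x\<in>F. x ^ k) = (\<Sum>x\<in>F - {0}. x ^ k) + 0 ^ k"
    by (subst sum.remove[of _ 0]) (auto simp: add.commute)
  also have "(\<Sum>x\<in>F - {0}. x ^ k) = of_nat (card (F - {0}))" using assms(1) by simp
  also have "card (F - {0}) = q - 1" by (simp add: card_F card_Diff_singleton)
  also have "(of_nat (q - 1) :: 'a) = 1"
    using m_pos by (simp add: of_nat_diff two_eq_0 zero_power)
  finally show ?thesis using assms(2) by simp
qed

lemma inverse_exponent:
  assumes "coprime n (q - 1)"
  obtains n' where "0 < n'" "[n * n' = 1] (mod q - 1)"
proof -
  obtain n' where n': "[n * n' = 1] (mod q - 1)" using cong_solve_coprime_nat[OF assms(1)] by auto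
  \<comment> \<open>Adding q - 1 to the inverse makes it positive, so that raising to the power n
    and back is the identity at 0 as well.\<close>
  have "[n * (q - 1) = 0] (mod q - 1)" by (simp only: cong_0_iff dvd_triv_right)
  from cong_add[OF n' this] have "[n * (n' + (q - 1)) = 1] (mod q - 1)" by (simp only: distrib_left add_0_right)
  with q_minus(2) show ?thesis by (intro that[of "n' + (q - 1)"] trans_less_add2)
qed

lemma pow_bij:
  assumes "coprime n (q - 1)" "0 < n"
  shows "bij_betw (\<lambda>x. x ^ n) F F"
proof -
  obtain n' where n': "0 < n'" "[n * n' = 1] (mod q - 1)"
    using inverse_exponent[OF assms(1)] .
  show ?thesis
    by (rule bij_betwI[of _ _ _ "\<lambda>x. x ^ n'"])
       (use n' F_pow_cong[OF _ n'(2)] assms(2) in \<open>auto simp: mult.commute[of n'] simp flip: power_mult\<close>)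
qed

lemma pow_eq_iff:
  assumes "coprime n (q - 1)" "0 < n" "x \<in> F" "y \<in> F"
  shows "x ^ n = y ^ n \<longleftrightarrow> x = y"
  using pow_bij[OF assms(1,2)] assms(3,4) by (auto simp: bij_betw_def inj_on_def)

lemma pow_surj:
  assumes "coprime n (q - 1)" "0 < n" "b \<in> F"
  obtains s where "s \<in> F" "s ^ n = b"
proof -
  have "b \<in> (\<lambda>x. x ^ n) ` F" using pow_bij[OF assms(1,2)] assms(3) by (simp add: bij_betw_def)
  thus ?thesis using that by blast
qed

lemma F_pow_dvd:
  assumes "x \<in> F" "x \<noteq> 0" "q - 1 dvd n" shows "x ^ n = 1"
proof -
  obtain k where "n = (q - 1) * k" using assms(3) by blast
  thus ?thesis using F_pow_minus_one[OF assms(1,2)] by (simp only: power_mult power_one)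
qed

text \<open>This separates the Frobenius conjugates inside a trace: after multiplication by the
  complementary power E only the unconjugated term survives the sum over F. If g is not fixed by the
  k-th Frobenius power and g = h^n, then h raised to the exponent of the sum is g^(2^k) / g, which
  differs from 1, and \<open>power_sum_0\<close> applies.\<close>

lemma frobenius_power_sum:
  assumes "coprime n (q - 1)" "0 < n" "q - 1 dvd n + E" "k < m"
  shows "(\<Sum>x\<in>F. x ^ (n * 2 ^ k + E)) = (if k = 0 then 1 else 0)"
proof (cases "k = 0")
  case True
  show ?thesis using power_sum_1[OF F_pow_dvd[OF _ _ assms(3)]] assms(2) True by simp
next
  case False
  then obtain g where g: "g \<in> F" "g ^ (2 ^ k) \<noteq> g" using pow2_fixed_imp[OF \<open>k < m\<close>] by blast
  obtain h where h: "h \<in> F" "h ^ n = g" using pow_surj[OF assms(1,2) g(1)] .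
  have "g \<noteq> 0" using g(2) by auto
  hence h0: "h \<noteq> 0" using h(2) assms(2) by auto
  have "g * h ^ E = 1" using F_pow_dvd[OF h(1) h0 assms(3)] h(2) by (simp add: power_add)
  moreover have "h ^ (n * 2 ^ k + E) = g ^ (2 ^ k) * h ^ E" using h(2) by (simp add: power_add power_mult)
  ultimately have "h ^ (n * 2 ^ k + E) \<noteq> 1" using g(2) by (metis mult_right_cancel mult_zero_right zero_neq_one)
  thus ?thesis using False power_sum_0[OF h(1) h0] by simp
qed

subsection \<open>Traces and Walsh sums\<close>

definition tF :: "'a \<Rightarrow> 'a" where "tF x = (\<Sum>k<m. x ^ (2 ^ k))"

lemma trF_eq: "trF m x = to_bit (tF x)"
  by (simp add: trF_def tF_def)

lemma tF_add: "tF (x + y) = tF x + tF y"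
  by (simp add: tF_def add_pow sum.distrib)

lemma tF_0 [simp]: "tF 0 = 0" by (simp add: tF_def power_0_left)

lemma tF_square:
  assumes "x \<in> F" shows "tF (x ^ 2) = tF x" "tF x ^ 2 = tF x"
proof -
  have "(\<Sum>k<m. x ^ (2 ^ Suc k)) = tF x"
    unfolding tF_def using sum.lessThan_Suc_shift[of "\<lambda>k. x ^ (2 ^ k)" m]
    by (simp add: F_pow_q[OF assms] add.commute)
  thus "tF (x ^ 2) = tF x" unfolding tF_def by (simp add: power_mult)
  moreover have "tF x ^ 2 = (\<Sum>k<m. (x ^ (2 ^ k)) ^ 2)"
    unfolding tF_def using sum_pow[of "\<lambda>k. x ^ (2 ^ k)" "{..<m}" 1] by simp
  moreover have "\<dots> = tF (x ^ 2)"
    unfolding tF_def by (intro sum.cong refl power_swap)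
  ultimately show "tF x ^ 2 = tF x" by simp
qed

lemma tF_pow2: "x \<in> F \<Longrightarrow> tF (x ^ (2 ^ k)) = tF x"
  by (induction k) (simp_all add: tF_square power_mult power_swap[of x 2])

lemma tF_cases: assumes "x \<in> F" obtains "tF x = 0" | "tF x = 1"
proof -
  have "tF x * (tF x + 1) = 0" using tF_square(2)[OF assms] by (simp add: power2_eq_square distrib_left)
  thus ?thesis using that by auto
qed

lemma trF_add: assumes "x \<in> F" "y \<in> F" shows "trF m (x + y) = trF m x + trF m y"
  by (rule tF_cases[OF assms(1)]; rule tF_cases[OF assms(2)]) (simp_all add: trF_eq tF_add)

lemma trF_0 [simp]: "trF m (0::'a) = 0" by (simp add: trF_eq)

lemma trF_pow2: "x \<in> F \<Longrightarrow> trF m (x ^ (2 ^ k)) = trF m x"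
  by (simp add: trF_eq tF_pow2)

text \<open>Transitivity of the trace: the exponents k and k + m contribute x and its conjugate to
  the same power 2^k.\<close>

lemma trK_eq: "trK m (x::'a) = trF m (x + conj x)"
proof -
  have shift: "x ^ (2 ^ (k + m)) = conj x ^ (2 ^ k)" for k
    unfolding bar_def power_add power_mult by (rule power_swap)
  have "(\<Sum>k<2 * m. x ^ (2 ^ k)) = (\<Sum>k = 0..<m. x ^ (2 ^ k)) + (\<Sum>k = m..<m + m. x ^ (2 ^ k))"
    unfolding lessThan_atLeast0 mult_2 by (rule sum.atLeastLessThan_concat[symmetric]) auto
  also have "\<dots> = (\<Sum>k = 0..<m. x ^ (2 ^ k)) + (\<Sum>k = 0..<m. x ^ (2 ^ (k + m)))"
    using sum.shift_bounds_nat_ivl[of "\<lambda>k. x ^ (2 ^ k)" 0 m m] by simp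
  also have "\<dots> = tF (x + conj x)"
    by (simp only: shift tF_def add_pow sum.distrib lessThan_atLeast0)
  finally show ?thesis by (simp add: trK_def trF_eq)
qed

lemma trK_form: "trK m (b * conj x) = trF m (form m b x)"
  by (simp add: trK_eq form_def conj_mult)

text \<open>If the trace vanished, so would the sum of \<open>tF c * c ^ (q - 2)\<close> over F; but
  this sum isolates the linear term of the trace polynomial and equals 1.\<close>

lemma trF_nontrivial: "\<exists>c\<in>F. trF m c = 1"
proof (rule ccontr)
  assume "\<not> ?thesis"
  hence tr0: "trF m c \<noteq> 1" if "c \<in> F" for c using that by blast
  have *: "tF c = 0" if "c \<in> F" for c
    by (rule tF_cases[OF that]) (use tr0[OF that] in \<open>auto simp: trF_eq\<close>)
  have eq: "(\<Sum>c\<in>F. c ^ (2 ^ k + (q - 2))) = (if k = 0 then 1 else 0)" if "k < m" for k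
  proof -
    have "1 + (q - 2) = q - 1" using q_gt_1 by simp
    hence "q - 1 dvd 1 + (q - 2)" by simp
    thus ?thesis using frobenius_power_sum[of 1 "q - 2", OF _ _ _ that] by simp
  qed
  have "0 = (\<Sum>c\<in>F. tF c * c ^ (q - 2))" using * by simp
  also have "\<dots> = (\<Sum>k<m. \<Sum>c\<in>F. c ^ (2 ^ k + (q - 2)))"
    unfolding tF_def sum_distrib_right power_add by (rule sum.swap)
  also have "\<dots> = (\<Sum>k<m. if k = 0 then 1 else 0)" by (rule sum.cong) (auto simp: eq)
  also have "\<dots> = 1" using m_pos by (simp add: sum.delta)
  finally show False by simp
qed

text \<open>For nonzero b, shifting c by d / b with d of trace 1 flips every sign, so the sum is its
  own negative.\<close>

lemma character_sum:
  assumes "b \<in> F"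
  shows "(\<Sum>c\<in>F. sign_bit (trF m (c * b))) = (if b = 0 then 2 ^ m else 0)"
proof (cases "b = 0")
  case False
  obtain d where d: "d \<in> F" "trF m d = 1" using trF_nontrivial by blast
  have "(\<Sum>c\<in>F. sign_bit (trF m (c * b))) = (\<Sum>c\<in>F. sign_bit (trF m ((c + d / b) * b)))"
    by (rule sum.reindex_bij_witness[of _ "\<lambda>c. c + d / b" "\<lambda>c. c + d / b"])
       (use assms d in \<open>auto simp: add.assoc\<close>)
  also have "\<dots> = (\<Sum>c\<in>F. - sign_bit (trF m (c * b)))"
    using False d assms
    by (intro sum.cong) (auto simp: distrib_right trF_add sign_bit_add sign_bit_def)
  finally show ?thesis using False by (simp add: sum_negf)
qed (simp add: sign_bit_def card_F)

text \<open>On Y \<noteq> 0 the substitution X = t Y turns the argument of the trace into Y (t^k +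
  \<alpha> t + \<beta>). Completing the sum over Y to all of F counts the roots t, at the cost of 1
  for each of the q values of t. The line Y = 0 supplies the extra term for \<alpha> = 0.\<close>

lemma walsh_sum:
  assumes "\<alpha> \<in> F" "\<beta> \<in> F" "0 < k" "k < q"
  shows "(\<Sum>X\<in>F. \<Sum>Y\<in>F. sign_bit (trF m (X ^ k * Y ^ (q - k) + \<alpha> * X + \<beta> * Y))) =
    2 ^ m * (int (card {t \<in> F. t ^ k + \<alpha> * t + \<beta> = 0}) + (if \<alpha> = 0 then 1 else 0) - 1)"
proof -
  let ?T = "{t \<in> F. t ^ k + \<alpha> * t + \<beta> = 0}"
  let ?s = "\<lambda>X Y. sign_bit (trF m (X ^ k * Y ^ (q - k) + \<alpha> * X + \<beta> * Y))"
  let ?p = "\<lambda>t. t ^ k + \<alpha> * t + \<beta>"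
  have line: "(\<Sum>X\<in>F. ?s X Y) = (\<Sum>t\<in>F. sign_bit (trF m (Y * ?p t)))"
    if "Y \<in> F - {0}" for Y
  proof -
    have expand: "(t * Y) ^ k * Y ^ (q - k) = Y * t ^ k" for t
    proof -
      have "(t * Y) ^ k * Y ^ (q - k) = t ^ k * Y ^ (k + (q - k))"
        by (simp only: power_mult_distrib power_add mult.assoc)
      also have "Y ^ (k + (q - k)) = Y" using assms(4) that by (simp add: F_pow_q)
      finally show ?thesis by simp
    qed
    have "(\<Sum>X\<in>F. ?s X Y) = (\<Sum>t\<in>F. ?s (t * Y) Y)"
      by (rule sum.reindex_bij_witness[of _ "\<lambda>t. t * Y" "\<lambda>X. X / Y"]) (use that in auto)
    thus ?thesis by (simp only: expand distrib_left ac_simps)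
  qed
  have "(\<Sum>X\<in>F. \<Sum>Y\<in>F. ?s X Y) = (\<Sum>Y\<in>F. \<Sum>X\<in>F. ?s X Y)" by (rule sum.swap)
  also have "\<dots> = (\<Sum>X\<in>F. ?s X 0) + (\<Sum>Y\<in>F - {0}. \<Sum>X\<in>F. ?s X Y)"
    by (rule sum.remove) auto
  also have "(\<Sum>X\<in>F. ?s X 0) = (\<Sum>X\<in>F. sign_bit (trF m (X * \<alpha>)))"
    using assms(4) by (simp add: zero_power mult.commute)
  also have "\<dots> = (if \<alpha> = 0 then 2 ^ m else 0)" by (rule character_sum[OF assms(1)])
  also have "(\<Sum>Y\<in>F - {0}. \<Sum>X\<in>F. ?s X Y) =
      (\<Sum>Y\<in>F - {0}. \<Sum>t\<in>F. sign_bit (trF m (Y * ?p t)))"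
    using line by (rule sum.cong[OF refl])
  also have "\<dots> = (\<Sum>t\<in>F. \<Sum>Y\<in>F - {0}. sign_bit (trF m (Y * ?p t)))" by (rule sum.swap)
  also have "\<dots> = (\<Sum>t\<in>F. (if t \<in> ?T then 2 ^ m else 0) - 1)"
  proof (rule sum.cong[OF refl])
    fix t assume t: "t \<in> F"
    have "(\<Sum>Y\<in>F. sign_bit (trF m (Y * ?p t))) = (if ?p t = 0 then 2 ^ m else 0)"
      using t assms by (intro character_sum) simp
    moreover have "(\<Sum>Y\<in>F. sign_bit (trF m (Y * ?p t))) =
        1 + (\<Sum>Y\<in>F - {0}. sign_bit (trF m (Y * ?p t)))"
      by (subst sum.remove[of _ 0]) (auto simp: sign_bit_def)
    ultimately show "(\<Sum>Y\<in>F - {0}. sign_bit (trF m (Y * ?p t))) = (if t \<in> ?T then 2 ^ m else 0) - 1"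
      using t by simp
  qed
  also have "\<dots> = 2 ^ m * int (card ?T) - 2 ^ m"
    by (simp add: sum_subtractf card_F sum.If_cases Int_def conj_commute)
  finally show ?thesis by (simp add: algebra_simps)
qed

text \<open>The total degree q acts as degree one on scalars of F, where c^q = c. For k =
  \<open>inv_exp m r\<close> this is the argument of the trace in \<open>f_third\<close>.\<close>

definition hom :: "nat \<Rightarrow> 'a \<Rightarrow> 'a" where
  "hom k x = cX x ^ k * cY x ^ (q - k)"

lemma hom_F [simp]: "hom k x \<in> F" by (simp add: hom_def)

lemma hom_scale:
  assumes "c \<in> F" "k \<le> q" shows "hom k (c * x) = c * hom k x"
proof -
  have "hom k (c * x) = c ^ (k + (q - k)) * hom k x"
    using assms(1) by (simp add: hom_def cX_scale cY_scale power_mult_distrib power_add)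
  thus ?thesis using assms by (simp add: F_pow_q)
qed

lemma form_coords: "form m b x = form m b 1 * cX x + form m b i * cY x"
proof -
  have "form m b x = form m b (cX x * 1 + cY x * i)" by (simp add: coords)
  also have "\<dots> = cX x * form m b 1 + cY x * form m b i"
    by (simp only: form_add form_scale cX_F cY_F)
  finally show ?thesis by (simp add: mult.commute)
qed

lemma card_power_eq:
  assumes "coprime k (q - 1)" "0 < k" "b \<in> F"
  shows "card {t \<in> F. t ^ k = b} = 1"
proof -
  obtain s where s: "s \<in> F" "s ^ k = b"
    by (rule pow_surj[OF assms])
  hence "{t \<in> F. t ^ k = b} = {s}" using pow_eq_iff[OF assms(1,2)] by auto
  thus ?thesis by simp
qed

text \<open>The left side is additive in t, so a nonempty solution set is a coset of the kernel. A
  nonzero kernel element z satisfies z^(2^n - 1) = b / a, which has exactly one solution because 2^n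
  - 1 is prime to q - 1.\<close>

lemma card_linearized:
  assumes "coprime n m" "0 < n" "a \<in> F" "b \<in> F" "c \<in> F" "a \<noteq> 0" "b \<noteq> 0"
  shows "card {t \<in> F. a * t ^ (2 ^ n) + b * t = c} \<in> {0, 2}" (is "card ?T \<in> _")
proof (cases "?T = {}")
  case False
  then obtain s where s: "s \<in> F" "a * s ^ (2 ^ n) + b * s = c" by auto
  have n: "1 < (2::nat) ^ n" using assms(2) by (intro one_less_power) auto
  have cop: "coprime (2 ^ n - 1) (q - 1)" by (rule coprime_two_power_minus_one[OF assms(1,2)])
  obtain z where z: "z \<in> F" "z ^ (2 ^ n - 1) = b / a"
    using pow_surj[OF cop _, of "b / a"] n assms by auto
  have z0: "z \<noteq> 0" using z(2) assms n by (auto simp: zero_power)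
  have factor: "a * v ^ (2 ^ n) = b * v \<longleftrightarrow> v = 0 \<or> v ^ (2 ^ n - 1) = b / a" for v
  proof -
    have "v ^ (2 ^ n) = v * v ^ (2 ^ n - 1)"
      using n by (simp flip: power_Suc)
    thus ?thesis using assms(6) by (auto simp: field_simps)
  qed
  have "t \<in> ?T \<longleftrightarrow> t = s \<or> t = s + z" if t: "t \<in> F" for t
  proof -
    have "t \<in> ?T \<longleftrightarrow> a * (t + s) ^ (2 ^ n) = b * (t + s)"
    proof -
      have "a * t ^ (2 ^ n) + b * t + c = a * (t + s) ^ (2 ^ n) + b * (t + s)"
        using s(2) by (simp add: add_pow algebra_simps)
      moreover have "t \<in> ?T \<longleftrightarrow> a * t ^ (2 ^ n) + b * t + c = 0" using t by simp
      ultimately show ?thesis by (simp only: add_eq_0_iff)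
    qed
    also have "\<dots> \<longleftrightarrow> (t + s = 0 \<or> (t + s) ^ (2 ^ n - 1) = b / a)"
      by (rule factor)
    also have "(t + s) ^ (2 ^ n - 1) = b / a \<longleftrightarrow> t + s = z"
      using pow_eq_iff[OF cop _ _ z(1), of "t + s"] n t s(1) z(2) by simp
    also have "t + s = 0 \<or> t + s = z \<longleftrightarrow> t = s \<or> t = s + z"
      by (metis add_eq_0_iff add_self_left add.commute)
    finally show ?thesis .
  qed
  hence "?T = {s, s + z}" using s(1) z(1) by auto
  thus ?thesis using z0 by (simp add: card_insert_if)
qed simp

text \<open>The summand with \<open>b\<^sub>0\<close> only moves the Walsh transform from b to
  \<open>b\<^sub>0 + b\<close>. For \<alpha> \<noteq> 0 the root counts 0 and 2 give the two
  admissible values; for \<alpha> = 0 there is one root, since k is prime to q - 1, and the line Y =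
  0 makes up for the other.\<close>

lemma bent_hom:
  assumes "coprime k (q - 1)" "0 < k" "k < q"
    and oval: "\<And>\<alpha> \<beta>. \<alpha> \<in> F \<Longrightarrow> \<beta> \<in> F \<Longrightarrow> \<alpha> \<noteq> 0 \<Longrightarrow> card {t \<in> F. t ^ k + \<alpha> * t + \<beta> = 0} \<in> {0, 2}"
  shows "bent m (\<lambda>x. trF m (hom k x + form m b\<^sub>0 x))"
  unfolding bent_def
proof
  fix b :: 'a
  define \<alpha> \<beta> where "\<alpha> = form m (b\<^sub>0 + b) 1" and "\<beta> = form m (b\<^sub>0 + b) i"
  let ?N = "card {t \<in> F. t ^ k + \<alpha> * t + \<beta> = 0}"
  have "trF m (hom k x + form m b\<^sub>0 x) + trK m (b * conj x) =
      trF m (cX x ^ k * cY x ^ (q - k) + \<alpha> * cX x + \<beta> * cY x)" for x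
  proof -
    have "trF m (hom k x + form m b\<^sub>0 x) + trK m (b * conj x) =
        trF m (hom k x + (form m b\<^sub>0 x + form m b x))"
      by (simp only: trK_form trF_add hom_F form_in_F F_add add.assoc)
    also have "form m b\<^sub>0 x + form m b x = \<alpha> * cX x + \<beta> * cY x"
      unfolding form_add_left[symmetric] \<alpha>_def \<beta>_def by (rule form_coords)
    finally show ?thesis by (simp add: hom_def ac_simps)
  qed
  hence "(\<Sum>x\<in>UNIV. sign_bit (trF m (hom k x + form m b\<^sub>0 x) + trK m (b * conj x))) =
      (\<Sum>x\<in>UNIV. sign_bit (trF m (cX x ^ k * cY x ^ (q - k) + \<alpha> * cX x + \<beta> * cY x)))"
    by simp
  also have "\<dots> = (\<Sum>X\<in>F. \<Sum>Y\<in>F. sign_bit (trF m (X ^ k * Y ^ (q - k) + \<alpha> * X + \<beta> * Y)))"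
    by (rule sum_coords)
  also have "\<dots> = 2 ^ m * (int ?N + (if \<alpha> = 0 then 1 else 0) - 1)"
    using assms by (intro walsh_sum) (auto simp: \<alpha>_def \<beta>_def)
  also have "\<dots> \<in> {2 ^ m, - (2 ^ m)}"
  proof (cases "\<alpha> = 0")
    case True
    have "?N = 1" using card_power_eq[OF assms(1,2), of \<beta>] True by (simp add: \<beta>_def)
    thus ?thesis using True by simp
  next
    case False
    have "2 ^ m * (int n + 0 - 1) \<in> {2 ^ m, - (2 ^ m)}" if "n \<in> {0, 2}" for n
      using that by auto
    moreover have "?N \<in> {0, 2}" by (rule oval) (use False in \<open>simp_all add: \<alpha>_def \<beta>_def\<close>)
    ultimately show ?thesis using False by (simp only: if_False)
  qed
  finally show "(\<Sum>x\<in>UNIV. sign_bit (trF m (hom k x + form m b\<^sub>0 x) + trK m (b * conj x)))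
    \<in> {2 ^ m, - (2 ^ m)}" .
qed

subsection \<open>Algebraic degree\<close>

text \<open>\<open>deg_less d f\<close> says that the algebraic normal form of \<open>f\<close> over the prime field has degree
  below \<open>d\<close>, expressed by the vanishing of all \<open>d\<close>-fold derivatives.\<close>

fun deg_less :: "nat \<Rightarrow> ('a \<Rightarrow> 'a) \<Rightarrow> bool" where
  "deg_less 0 f \<longleftrightarrow> (\<forall>x. f x = 0)"
| "deg_less (Suc d) f \<longleftrightarrow> (\<forall>a. deg_less d (\<lambda>x. f (x + a) + f x))"

lemma deg_less_zero [simp]: "deg_less d (\<lambda>_. 0)"
  by (induction d) auto

lemma deg_less_add: "deg_less d f \<Longrightarrow> deg_less d g \<Longrightarrow> deg_less d (\<lambda>x. f x + g x)"
proof (induction d arbitrary: f g)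
  case (Suc d)
  have "deg_less d (\<lambda>x. (f (x + a) + f x) + (g (x + a) + g x))" for a using Suc by simp
  thus ?case by (simp add: ac_simps)
qed simp

lemma deg_less_sum: "(\<And>k. k \<in> A \<Longrightarrow> deg_less d (f k)) \<Longrightarrow> deg_less d (\<lambda>x. \<Sum>k\<in>A. f k x)"
  by (induction A rule: infinite_finite_induct) (auto intro: deg_less_add)

lemma deg_less_cmult: "deg_less d f \<Longrightarrow> deg_less d (\<lambda>x. c * f x)"
proof (induction d arbitrary: f)
  case (Suc d)
  have "deg_less d (\<lambda>x. c * (f (x + a) + f x))" for a using Suc by simp
  thus ?case by (simp add: distrib_left)
qed simp

lemma deg_less_shift: "deg_less d f \<Longrightarrow> deg_less d (\<lambda>x. f (x + b))"
proof (induction d arbitrary: f)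
  case (Suc d)
  have "deg_less d (\<lambda>x. f ((x + b) + a) + f (x + b))" for a
    using Suc.IH[of "\<lambda>x. f (x + a) + f x"] Suc.prems by simp
  thus ?case by (simp add: ac_simps)
qed simp

lemma deg_less_Suc: "deg_less d f \<Longrightarrow> deg_less (Suc d) f"
proof (induction d arbitrary: f)
  case (Suc d)
  thus ?case by (metis deg_less.simps(2))
qed simp

lemma deg_less_mono: "d \<le> d' \<Longrightarrow> deg_less d f \<Longrightarrow> deg_less d' f"
  by (induction d' rule: dec_induct) (auto intro: deg_less_Suc simp del: deg_less.simps)

lemma deg_less_const: "deg_less (Suc 0) (\<lambda>_. c)"
  by simp

text \<open>Product rule: the derivative of f A in direction a is (f (x + a) + f x) A x + A a f (x +
  a), where A a is a constant.\<close>

lemma deg_less_mult_additive: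
  assumes "deg_less d f" and A: "\<And>x y. A (x + y) = A x + A y"
  shows "deg_less (Suc d) (\<lambda>x. f x * A x)"
  using assms(1)
proof (induction d arbitrary: f)
  case (Suc d)
  have "deg_less (Suc d) (\<lambda>x. f (x + a) * A (x + a) + f x * A x)" for a
  proof -
    have "deg_less (Suc d) (\<lambda>x. (f (x + a) + f x) * A x)"
      using Suc.prems by (intro Suc.IH) simp
    moreover have "deg_less (Suc d) (\<lambda>x. A a * f (x + a))"
      by (intro deg_less_cmult deg_less_shift Suc.prems)
    ultimately have "deg_less (Suc d) (\<lambda>x. (f (x + a) + f x) * A x + A a * f (x + a))"
      by (rule deg_less_add)
    moreover have "(f (x + a) + f x) * A x + A a * f (x + a) = f (x + a) * A (x + a) + f x * A x" for x
      by (simp add: A algebra_simps)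
    ultimately show ?thesis by simp
  qed
  thus ?case using deg_less.simps(2) by blast
qed simp

lemma deg_less_mult_prod:
  assumes "deg_less d f" "finite I" and A: "\<And>t x y. t \<in> I \<Longrightarrow> A t (x + y) = A t x + A t y"
  shows "deg_less (d + card I) (\<lambda>x. f x * (\<Prod>t\<in>I. A t x))"
  using assms(2,3)
proof (induction I)
  case empty
  thus ?case using assms(1) by simp
next
  case (insert t I)
  have "deg_less (Suc (d + card I)) (\<lambda>x. (f x * (\<Prod>t\<in>I. A t x)) * A t x)"
    by (rule deg_less_mult_additive) (use insert in auto)
  thus ?case using insert by (simp add: ac_simps del: deg_less.simps)
qed

text \<open>A k-fold derivative along independent directions is the sum over a translate of their
  span. Joining H with its coset by an outside vector a amounts to one more derivative. At k = 2 m
  the span is all of K, which gives \<open>sum_deg_less\<close>.\<close>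

lemma exists_subspace:
  assumes "k \<le> 2 * m"
  shows "\<exists>H. card H = 2 ^ k \<and> 0 \<in> H \<and> (\<forall>x\<in>H. \<forall>y\<in>H. x + y \<in> H) \<and>
    (\<forall>f. deg_less k f \<longrightarrow> (\<forall>x. (\<Sum>h\<in>H. f (x + h)) = 0))"
  using assms
proof (induction k)
  case 0
  show ?case by (rule exI[of _ "{0}"]) simp
next
  case (Suc k)
  then obtain H where H: "card H = 2 ^ k" "0 \<in> H" "\<And>x y. x \<in> H \<Longrightarrow> y \<in> H \<Longrightarrow> x + y \<in> H"
    and sum: "\<And>f x. deg_less k f \<Longrightarrow> (\<Sum>h\<in>H. f (x + h)) = 0"
    by auto
  have "H \<noteq> UNIV"
  proof
    assume "H = UNIV"
    hence "(2::nat) ^ k = 2 ^ (2 * m)" using H(1) card_K by simp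
    thus False using Suc.prems by simp
  qed
  then obtain a where a: "a \<notin> H" by blast
  let ?H' = "H \<union> (+) a ` H"
  have disj: "H \<inter> (+) a ` H = {}"
  proof (rule ccontr)
    assume "\<not> ?thesis"
    then obtain h where "h \<in> H" "a + h \<in> H" by auto
    hence "h + (a + h) \<in> H" using H(3) by blast
    thus False using a by (simp add: add.left_commute)
  qed
  show ?case
  proof (intro exI[of _ ?H'] conjI ballI allI impI)
    show "card ?H' = 2 ^ Suc k"
      using disj H(1) by (simp add: card_Un_disjoint card_image)
    show "0 \<in> ?H'" using H(2) by simp
    show "x + y \<in> ?H'" if x: "x \<in> ?H'" and y: "y \<in> ?H'" for x y
    proof -
      consider "x \<in> H" | h where "h \<in> H" "x = a + h" using x by auto
      thus ?thesis
      proof cases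
        case 1
        consider "y \<in> H" | g where "g \<in> H" "y = a + g" using y by auto
        thus ?thesis using 1 H(3) by cases (auto simp: add.left_commute)
      next
        case (2 h)
        consider "y \<in> H" | g where "g \<in> H" "y = a + g" using y by auto
        thus ?thesis using 2 H(3) by cases (auto simp: add.assoc add.left_commute[of h a])
      qed
    qed
    fix f x assume "deg_less (Suc k) f"
    hence d: "deg_less k (\<lambda>x. f (x + a) + f x)" by simp
    have "(\<Sum>h\<in>?H'. f (x + h)) = (\<Sum>h\<in>H. f (x + h)) + (\<Sum>h\<in>H. f (x + (a + h)))"
      using disj by (simp add: sum.union_disjoint sum.reindex)
    also have "\<dots> = (\<Sum>h\<in>H. f ((x + h) + a) + f (x + h))"
      by (simp add: sum.distrib ac_simps)
    also have "\<dots> = 0" by (rule sum[OF d])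
    finally show "(\<Sum>h\<in>?H'. f (x + h)) = 0" .
  qed
qed

lemma sum_deg_less:
  assumes "deg_less (2 * m) f" shows "(\<Sum>x\<in>UNIV. f x) = 0"
proof -
  obtain H where H: "card H = 2 ^ (2 * m)" "\<And>f x. deg_less (2 * m) f \<Longrightarrow> (\<Sum>h\<in>H. f (x + h)) = 0"
    using exists_subspace[OF order_refl] by blast
  have "H = UNIV" using H(1) card_K by (metis card_subset_eq finite subset_UNIV)
  thus ?thesis using H(2)[OF assms, of 0] by simp
qed

text \<open>With values in K the trace may be expanded into its conjugates and multiplied by
  additive functions of K.\<close>

definition lift_bit :: "bit \<Rightarrow> 'a" where "lift_bit b = (if b = 0 then 0 else 1)"

lemma lift_bit_add: "lift_bit (a + b) = lift_bit a + lift_bit b"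
  by (cases a; cases b) (simp_all add: lift_bit_def)

lemma lift_trF: "x \<in> F \<Longrightarrow> lift_bit (trF m x) = tF x"
  by (rule tF_cases[of x]) (simp_all add: trF_eq lift_bit_def)

text \<open>The derivative of the composition in direction a is the derivative of f in direction A
  a, composed with the same affine map.\<close>

lemma deg_less_comp_affine:
  assumes "deg_less d f" "\<And>x y. A (x + y) = A x + A y"
  shows "deg_less d (\<lambda>x. f (A x + c))"
  using assms(1)
proof (induction d arbitrary: f)
  case (Suc d)
  have "deg_less d (\<lambda>x. f (A x + c + A a) + f (A x + c))" for a
    using Suc.IH[of "\<lambda>x. f (x + A a) + f x"] Suc.prems by simp
  thus ?case by (simp add: assms(2) ac_simps)
qed simp

text \<open>The condition \<open>2 \<le> d\<close> absorbs the affine summand, whose degree is at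
  most one.\<close>

lemma deg_less_bool_equiv:
  assumes "bool_equiv f f'" "deg_less d (\<lambda>x. lift_bit (f x))" "2 \<le> d"
  shows "deg_less d (\<lambda>x. lift_bit (f' x))"
proof -
  obtain L l where L: "affine2 L" "affine2 l" "f' = (\<lambda>x. f (L x) + l x)"
    using assms(1) by (auto simp: bool_equiv_def)
  obtain A c where A: "Modules.additive A" "L = (\<lambda>x. A x + c)" using L(1) by (auto simp: affine2_def)
  obtain B b where B: "Modules.additive B" "l = (\<lambda>x. B x + b)" using L(2) by (auto simp: affine2_def)
  have "deg_less d (\<lambda>x. lift_bit (f (A x + c)))"
    using deg_less_comp_affine[OF assms(2)] additive.add[OF A(1)] by blast
  moreover have "deg_less d (\<lambda>x. lift_bit (B x + b))"
  proof (rule deg_less_mono[OF assms(3)])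
    have "deg_less (Suc (Suc 0)) (\<lambda>x. 1 * lift_bit (B x))"
      by (rule deg_less_mult_additive[OF deg_less_const]) (simp only: additive.add[OF B(1)] lift_bit_add)
    thus "deg_less 2 (\<lambda>x. lift_bit (B x + b))"
      unfolding lift_bit_add numeral_2_eq_2 mult_1
      by (rule deg_less_add) (rule deg_less_Suc[OF deg_less_const])
  qed
  ultimately show ?thesis unfolding L(3) A(2) B(2) lift_bit_add[of "f _"] by (rule deg_less_add)
qed

section \<open>Degrees of the functions tr(X^k Y^(q-k))\<close>

lemma cX_pow2_add: "cX (x + y) ^ (2 ^ k) = cX x ^ (2 ^ k) + cX y ^ (2 ^ k)"
  and cY_pow2_add: "cY (x + y) ^ (2 ^ k) = cY x ^ (2 ^ k) + cY y ^ (2 ^ k)"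
  by (simp_all add: cX_add cY_add add_pow)

lemma prod_pow2: "a \<le> b \<Longrightarrow> (\<Prod>t = a..<b. x ^ (2 ^ t)) = (x::'a) ^ (2 ^ b - 2 ^ a)"
proof (induction b rule: dec_induct)
  case (step n)
  have eq: "2 ^ Suc n - 2 ^ a = (2 ^ n - 2 ^ a) + (2 ^ n :: nat)"
    using power_increasing[OF step.hyps(1), of "2::nat"] by simp
  have "(\<Prod>t = a..<Suc n. x ^ (2 ^ t)) = x ^ (2 ^ n - 2 ^ a) * x ^ (2 ^ n)"
    using step by simp
  thus ?case unfolding eq power_add .
qed simp

text \<open>Raising to the power 2^(m-j) does not change the trace. It turns the X-part into X and
  the Y-part into Y^(2^(m-j) - 1), whose exponent has m - j binary ones.\<close>

lemma lift_hom_pow2: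
  assumes "j < m"
  shows "lift_bit (trF m (hom (2 ^ j) x)) = (\<Sum>k<m. cX x ^ (2 ^ k) * (\<Prod>t<m - j. cY x ^ (2 ^ (t + k))))"
proof -
  have "trF m (hom (2 ^ j) x) = trF m (hom (2 ^ j) x ^ (2 ^ (m - j)))" by (simp add: trF_pow2)
  also have "hom (2 ^ j) x ^ (2 ^ (m - j)) = cX x * cY x ^ (2 ^ (m - j) - 1)"
  proof -
    have 1: "(cX x ^ 2 ^ j) ^ 2 ^ (m - j) = cX x"
      using assms F_pow_q[of "cX x"] by (simp flip: power_mult power_add)
    have "(q - 2 ^ j) * 2 ^ (m - j) = q * (2 ^ (m - j) - 1)"
      using assms by (simp add: diff_mult_distrib diff_mult_distrib2 flip: power_add)
    hence "(cY x ^ (q - 2 ^ j)) ^ 2 ^ (m - j) = (cY x ^ q) ^ (2 ^ (m - j) - 1)"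
      by (simp only: flip: power_mult)
    thus ?thesis using 1 by (simp add: hom_def power_mult_distrib F_pow_q)
  qed
  finally have "lift_bit (trF m (hom (2 ^ j) x)) = tF (cX x * cY x ^ (2 ^ (m - j) - 1))"
    by (simp add: lift_trF)
  also have "\<dots> = (\<Sum>k<m. cX x ^ (2 ^ k) * (\<Prod>t<m - j. cY x ^ (2 ^ (t + k))))"
  proof -
    have "(cX x * cY x ^ (2 ^ (m - j) - 1)) ^ (2 ^ k) = cX x ^ (2 ^ k) * (\<Prod>t<m - j. cY x ^ (2 ^ (t + k)))" for k
    proof -
      have "(cY x ^ (2 ^ (m - j) - 1)) ^ (2 ^ k) = (\<Prod>t<m - j. cY x ^ (2 ^ (t + k)))"
      proof -
        have "(cY x ^ (2 ^ (m - j) - 1)) ^ (2 ^ k) = (\<Prod>t<m - j. cY x ^ (2 ^ t)) ^ (2 ^ k)"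
          using prod_pow2[of 0 "m - j" "cY x"] by (simp add: lessThan_atLeast0)
        thus ?thesis by (simp add: prod_power_distrib power_add power_mult)
      qed
      thus ?thesis by (simp only: power_mult_distrib)
    qed
    thus ?thesis by (simp only: tF_def)
  qed
  finally show ?thesis .
qed

text \<open>Every summand of the expansion is a product of m - j + 1 additive functions;
  \<open>deg_less\<close> is a strict bound.\<close>

lemma deg_hom_pow2:
  assumes "j < m"
  shows "deg_less (m - j + 2) (\<lambda>x. lift_bit (trF m (hom (2 ^ j) x)))"
  unfolding lift_hom_pow2[OF assms]
proof (rule deg_less_sum)
  fix k
  have "deg_less (Suc (Suc 0)) (\<lambda>x. 1 * cX x ^ (2 ^ k))"
    by (rule deg_less_mult_additive[OF deg_less_const]) (rule cX_pow2_add)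
  hence "deg_less (Suc (Suc 0) + card {..<m - j}) (\<lambda>x. (1 * cX x ^ (2 ^ k)) * (\<Prod>t<m - j. cY x ^ (2 ^ (t + k))))"
    by (rule deg_less_mult_prod) (auto simp: cY_pow2_add)
  thus "deg_less (m - j + 2) (\<lambda>x. cX x ^ (2 ^ k) * (\<Prod>t<m - j. cY x ^ (2 ^ (t + k))))"
    by (simp del: deg_less.simps)
qed

lemma lift_hom_sum:
  "lift_bit (trF m (hom k x)) = (\<Sum>j<m. cX x ^ (k * 2 ^ j) * cY x ^ ((q - k) * 2 ^ j))"
  by (simp add: lift_trF tF_def hom_def power_mult_distrib power_mult)

lemma sum_coords_prod: "(\<Sum>x\<in>UNIV. cX x ^ a * cY x ^ b) = (\<Sum>X\<in>F. X ^ a) * (\<Sum>Y\<in>F. Y ^ b)"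
  by (simp add: sum_coords[of "\<lambda>X Y. X ^ a * Y ^ b"] sum_product)

text \<open>Multiplying by monomials of complementary degree isolates one coefficient of the
  algebraic normal form, because the sum over K of a function of degree below \<open>2m\<close> vanishes.\<close>

lemma hom_not_deg_less:
  assumes "coprime k (q - 1)" "0 < k" "k < q" "q - 1 dvd k + A" "q - 1 dvd (q - k) + B"
    and I: "finite I" "\<And>x. (\<Prod>t\<in>I. x ^ (2 ^ \<phi> t)) = (x::'a) ^ A"
    and J: "finite J" "\<And>x. (\<Prod>t\<in>J. x ^ (2 ^ \<psi> t)) = (x::'a) ^ B"
    and d: "d + card I + card J = 2 * m"
  shows "\<not> deg_less d (\<lambda>x. lift_bit (trF m (hom k x)))"
proof
  let ?h = "\<lambda>x. lift_bit (trF m (hom k x))"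
  assume "deg_less d ?h"
  hence "deg_less (d + card I) (\<lambda>x. ?h x * (\<Prod>t\<in>I. cX x ^ (2 ^ \<phi> t)))"
    by (rule deg_less_mult_prod[OF _ I(1)]) (rule cX_pow2_add)
  hence "deg_less (d + card I + card J)
      (\<lambda>x. ?h x * (\<Prod>t\<in>I. cX x ^ (2 ^ \<phi> t)) * (\<Prod>t\<in>J. cY x ^ (2 ^ \<psi> t)))"
    by (rule deg_less_mult_prod[OF _ J(1)]) (rule cY_pow2_add)
  hence "0 = (\<Sum>x\<in>UNIV. ?h x * cX x ^ A * cY x ^ B)"
    unfolding d I(2) J(2) by (rule sum_deg_less[symmetric])
  also have "\<dots> = (\<Sum>x\<in>UNIV. \<Sum>j<m. cX x ^ (k * 2 ^ j + A) * cY x ^ ((q - k) * 2 ^ j + B))"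
    by (simp add: lift_hom_sum sum_distrib_left sum_distrib_right power_add mult_ac)
  also have "\<dots> = (\<Sum>j<m. \<Sum>x\<in>UNIV. cX x ^ (k * 2 ^ j + A) * cY x ^ ((q - k) * 2 ^ j + B))"
    by (rule sum.swap)
  also have "\<dots> = (\<Sum>j<m. if j = 0 then 1 else 0)"
  proof (rule sum.cong[OF refl])
    fix j assume "j \<in> {..<m}"
    \<comment> \<open>The X-factor alone annihilates every j \<noteq> 0, so the sum over Y has to be
      known only for j = 0.\<close>
    hence X: "(\<Sum>X\<in>F. X ^ (k * 2 ^ j + A)) = (if j = 0 then 1 else 0)"
      by (intro frobenius_power_sum assms(1,2,4)) simp
    have "(\<Sum>Y\<in>F. Y ^ ((q - k) + B)) = 1"
      by (rule power_sum_1[OF F_pow_dvd[OF _ _ assms(5)]]) (use assms(3) in auto)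
    thus "(\<Sum>x\<in>UNIV. cX x ^ (k * 2 ^ j + A) * cY x ^ ((q - k) * 2 ^ j + B)) = (if j = 0 then 1 else 0)"
      unfolding sum_coords_prod X by simp
  qed
  also have "\<dots> = 1" using m_pos by (simp add: sum.delta)
  finally show False by simp
qed

text \<open>Among m binary digits, 2^j occupies the place j and q - 2^j the places from j on. I and
  J are the complementary sets of places, with m - 1 and j elements.\<close>

lemma not_deg_hom_pow2:
  assumes "j < m" shows "\<not> deg_less (m - j + 1) (\<lambda>x. lift_bit (trF m (hom (2 ^ j) x)))"
proof -
  have j: "(2::nat) ^ j < q" using assms by simp
  have le: "(2::nat) ^ j \<ge> 1" by simp
  show ?thesis
  proof (rule hom_not_deg_less[where I = "{..<m} - {j}" and J = "{..<j}"
        and \<phi> = "\<lambda>t. t" and \<psi> = "\<lambda>t. t" and A = "q - 1 - 2 ^ j" and B = "2 ^ j - 1"])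
    show "coprime (2 ^ j) (q - 1)" using m_pos by (simp add: coprime_power_left_iff)
    have "2 ^ j + (q - 1 - 2 ^ j) = q - 1" using j by linarith
    thus "q - 1 dvd 2 ^ j + (q - 1 - 2 ^ j)" by simp
    have "(q - 2 ^ j) + (2 ^ j - 1) = q - 1" using j le by linarith
    thus "q - 1 dvd (q - 2 ^ j) + (2 ^ j - 1)" by simp
    show "(\<Prod>t<j. x ^ 2 ^ t) = x ^ (2 ^ j - 1)" for x :: 'a
      using prod_pow2[of 0 j x] by (simp add: lessThan_atLeast0)
    have "(\<Sum>t\<in>{..<m} - {j}. 2 ^ t) + 2 ^ j = (\<Sum>t<m. 2 ^ t :: nat)"
      using assms by (subst sum.remove[of "{..<m}" j]) auto
    hence "(\<Sum>t\<in>{..<m} - {j}. 2 ^ t :: nat) = q - 1 - 2 ^ j" using mask_eq_sum_exp_nat[of m] by (simp add: lessThan_def)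
    thus "(\<Prod>t\<in>{..<m} - {j}. x ^ 2 ^ t) = x ^ (q - 1 - 2 ^ j)" for x :: 'a
      by (simp flip: power_sum)
    show "m - j + 1 + card ({..<m} - {j}) + card {..<j} = 2 * m"
      using assms by (simp add: card_Diff_singleton)
  qed (use j in auto)
qed

subsection \<open>Hyperovals in the two models of the plane\<close>

lemma coords_eq_0:
  assumes "X \<in> F" "Y \<in> F" shows "X + Y * i = 0 \<longleftrightarrow> X = 0 \<and> Y = 0"
  using cXY_eq_0[of "X + Y * i"] unfolding cX_coords[OF assms] cY_coords[OF assms] by (rule sym)

lemma mem_unitS_iff: "u \<in> unitS m \<longleftrightarrow> u * conj u = (1::'a)"
  by (simp add: unitS_def)

text \<open>For x = \<lambda> u with u on the unit circle \<open>x * conj x\<close> is the square of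
  \<lambda>, and on F the power 2^(m-1) is the square root.\<close>

definition nrm :: "'a \<Rightarrow> 'a" where "nrm x = (x * conj x) ^ (2 ^ (m - 1))"

lemma sqrt_F: assumes "c \<in> F" shows "(c * c) ^ (2 ^ (m - 1)) = c"
proof -
  have "c ^ (2 * 2 ^ (m - 1)) = c" using F_pow_q[OF assms] m_pos by (simp flip: power_Suc)
  thus ?thesis by (simp only: power_mult power2_eq_square)
qed

lemma nrm_polar: assumes "c \<in> F" "u \<in> unitS m" shows "nrm (c * u) = c"
proof -
  have "c * u * conj (c * u) = c * c * (u * conj u)"
    unfolding conj_mult conj_F[OF assms(1)] by (simp only: mult_ac)
  also have "\<dots> = c * c" using assms(2) by (simp add: mem_unitS_iff)
  finally have eq: "c * u * conj (c * u) = c * c" .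
  show ?thesis unfolding nrm_def eq by (rule sqrt_F[OF assms(1)])
qed

lemma polar:
  assumes "x \<noteq> 0" obtains c u where "c \<in> F" "c \<noteq> 0" "u \<in> unitS m" "x = c * u"
proof (rule that)
  have F: "x * conj x \<in> F" by (simp add: mem_F_iff conj_mult mult.commute)
  show nF: "nrm x \<in> F" using F by (simp add: nrm_def)
  show n0: "nrm x \<noteq> 0" using assms by (simp add: nrm_def)
  have "nrm x * nrm x = x * conj x"
    unfolding nrm_def power_mult_distrib[symmetric] using sqrt_F[OF F] .
  moreover have "conj (x / nrm x) = conj x / nrm x"
    unfolding bar_def power_divide F_pow_q[OF nF] ..
  ultimately show "x / nrm x \<in> unitS m" using n0 assms by (simp add: mem_unitS_iff)
  show "x = nrm x * (x / nrm x)" using n0 by simp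
qed

text \<open>The function \<open>\<lambda>u \<mapsto> \<lambda> g(u)\<close> on K, with \<open>nrm\<close> reading off \<open>\<lambda>\<close>.\<close>

definition homogeneous_ext :: "('a \<Rightarrow> 'a) \<Rightarrow> 'a \<Rightarrow> 'a" where
  "homogeneous_ext g x = nrm x * g (x / nrm x)"

lemma homogeneous_ext_polar:
  assumes "c \<in> F" "u \<in> unitS m"
  shows "homogeneous_ext g (c * u) = c * g u"
  using assms nrm_polar[OF assms] by (cases "c = 0") (simp_all add: homogeneous_ext_def)

lemma pointP_self: "(x, z) \<in> pointP m x (z::'a)"
  unfolding pointP_def using F_one by (auto intro!: exI[of _ 1])

lemma units_mult_image:
  assumes "c \<in> F" "c \<noteq> 0" shows "(\<lambda>d. d * c) ` {d \<in> F. d \<noteq> 0} = {d \<in> F. d \<noteq> 0}"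
proof (intro equalityI subsetI)
  fix d assume "d \<in> {d \<in> F. d \<noteq> 0}"
  thus "d \<in> (\<lambda>d. d * c) ` {d \<in> F. d \<noteq> 0}" using assms by (intro image_eqI[of _ _ "d / c"]) auto
qed (use assms in auto)

lemma pointP_image: "pointP m x z = (\<lambda>c. (c * x, c * z)) ` {c \<in> F. c \<noteq> (0::'a)}"
  unfolding pointP_def by auto

lemma pointP_scale:
  assumes "c \<in> F" "c \<noteq> 0" shows "pointP m (c * x) (c * z) = pointP m x (z::'a)"
proof -
  have "pointP m (c * x) (c * z) = (\<lambda>d. (d * x, d * z)) ` (\<lambda>d. d * c) ` {d \<in> F. d \<noteq> 0}"
    unfolding pointP_image image_image by (simp only: mult.assoc)
  thus ?thesis unfolding units_mult_image[OF assms] pointP_image .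
qed

text \<open>Clearing the denominator in (u/c : 1) = (u : c) removes the separate treatment of c =
  0.\<close>

lemma quot_point_eq:
  assumes "c \<in> F" shows "quot_point m u c = pointP m u (c::'a)"
  using pointP_scale[of "inverse c" u c] assms by (auto simp: quot_point_def divide_inverse mult.commute)

text \<open>By the polar decomposition the points parametrised by u form the graph of the
  homogeneous function G, so membership can be read off any representative; x = 0 is the
  nucleus.\<close>

lemma pointP_mem_hyperoval:
  assumes g: "\<And>u. u \<in> unitS m \<Longrightarrow> g u \<in> F"
    and G: "\<And>c u. c \<in> F \<Longrightarrow> u \<in> unitS m \<Longrightarrow> G (c * u) = c * g u"
    and "z \<in> F" "(x, z) \<noteq> (0, 0)"
  shows "pointP m x z \<in> niho_hyperoval m g \<longleftrightarrow> x = 0 \<or> z = G x"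
proof -
  have hyperoval: "P \<in> niho_hyperoval m g \<longleftrightarrow> (\<exists>u\<in>unitS m. P = pointP m u (g u)) \<or> P = pointP m 0 1" for P
    unfolding niho_hyperoval_def using quot_point_eq[OF g] by (simp add: Bex_def) metis
  show ?thesis
  proof
    assume "pointP m x z \<in> niho_hyperoval m g"
    then consider u where "u \<in> unitS m" "pointP m x z = pointP m u (g u)" | "pointP m x z = pointP m 0 1"
      unfolding hyperoval by blast
    thus "x = 0 \<or> z = G x"
    proof cases
      case (1 u)
      hence "(x, z) \<in> pointP m u (g u)" using pointP_self[of x z] by simp
      thus ?thesis using G 1(1) by (auto simp: pointP_def)
    next
      case 2
      hence "(x, z) \<in> pointP m 0 1" using pointP_self[of x z] by simp
      thus ?thesis by (auto simp: pointP_def)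
    qed
  next
    assume *: "x = 0 \<or> z = G x"
    show "pointP m x z \<in> niho_hyperoval m g"
    proof (cases "x = 0")
      case True
      thus ?thesis using pointP_scale[of z 0 1] assms(3,4) by (simp add: hyperoval)
    next
      case False
      then obtain c u where cu: "c \<in> F" "c \<noteq> 0" "u \<in> unitS m" "x = c * u" by (rule polar)
      hence "pointP m x z = pointP m u (g u)" using * False G pointP_scale[of c u "g u"] by simp
      thus ?thesis using cu(3) unfolding hyperoval by blast
    qed
  qed
qed

section \<open>Vectors over F and the triple model\<close>

abbreviation F3 :: "('a ^ 3) set" where "F3 \<equiv> {v. \<forall>k. v $ k \<in> F}"

lemma vec3_eq_iff: "v = w \<longleftrightarrow> v $ 1 = w $ 1 \<and> v $ 2 = w $ 2 \<and> v $ 3 = (w $ 3 :: 'b)"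
  for v w :: "'b ^ 3"
  by (simp add: vec_eq_iff forall_3)

lemma pointT_self: "v \<in> pointT m (v :: 'a ^ 3)"
  unfolding pointT_def using F_one by (auto intro!: exI[of _ 1])

lemma pointT_image: "pointT m v = (\<lambda>c. c *s v) ` {c \<in> F. c \<noteq> (0::'a)}"
  unfolding pointT_def by auto

lemma pointT_scale:
  assumes "c \<in> F" "c \<noteq> 0" shows "pointT m (c *s v) = pointT m (v :: 'a ^ 3)"
proof -
  have "pointT m (c *s v) = (\<lambda>d. d *s v) ` (\<lambda>d. d * c) ` {d \<in> F. d \<noteq> 0}"
    unfolding pointT_image image_image by (simp only: vector_smult_assoc)
  thus ?thesis unfolding units_mult_image[OF assms] pointT_image .
qed

text \<open>The first disjunct is the line of vectors over the nucleus \<open>(0:0:1)\<close>.\<close>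

definition cone :: "('a \<Rightarrow> 'a) \<Rightarrow> ('a ^ 3) set" where
  "cone G = {v \<in> F3. v \<noteq> 0 \<and> (v $ 1 + v $ 2 * i = 0 \<or> v $ 3 = G (v $ 1 + v $ 2 * i))}"

lemma to_triples_hyperoval:
  assumes g: "\<And>u. u \<in> unitS m \<Longrightarrow> g u \<in> F"
    and G: "\<And>c u. c \<in> F \<Longrightarrow> u \<in> unitS m \<Longrightarrow> G (c * u) = c * g u"
  shows "to_triples m i (niho_hyperoval m g) = pointT m ` cone G"
proof -
  have "triple_to_pair i ` pointT m v \<in> niho_hyperoval m g \<longleftrightarrow> v \<in> cone G"
    if v: "v \<in> F3" "v \<noteq> 0" for v
  proof -
    have "triple_to_pair i ` pointT m v = pointP m (v $ 1 + v $ 2 * i) (v $ 3)"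
      unfolding pointT_image pointP_image image_image
      by (intro image_cong refl) (simp add: triple_to_pair_def algebra_simps)
    moreover have "(v $ 1 + v $ 2 * i, v $ 3) \<noteq> (0, 0)"
    proof
      assume eq: "(v $ 1 + v $ 2 * i, v $ 3) = (0, 0)"
      have "v $ 1 \<in> F" "v $ 2 \<in> F" using v(1) by auto
      moreover have "v $ 1 + v $ 2 * i = 0" using eq by (simp only: prod.inject)
      ultimately have "v $ 1 = 0 \<and> v $ 2 = 0" by (simp only: coords_eq_0)
      thus False using v(2) eq by (simp add: vec3_eq_iff)
    qed
    ultimately show ?thesis
      using pointP_mem_hyperoval[OF g G, of "v $ 3" "v $ 1 + v $ 2 * i"] v by (simp add: cone_def)
  qed
  thus ?thesis unfolding to_triples_def PG2_def by (auto simp: cone_def)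
qed

subsection \<open>Semilinear maps\<close>

lemma automorphism_props:
  assumes "automorphismF m \<sigma>"
  shows "\<And>x. x \<in> F \<Longrightarrow> \<sigma> x \<in> F" "\<And>x y. x \<in> F \<Longrightarrow> y \<in> F \<Longrightarrow> \<sigma> (x + y) = \<sigma> x + \<sigma> y"
    "\<And>x y. x \<in> F \<Longrightarrow> y \<in> F \<Longrightarrow> \<sigma> (x * y) = \<sigma> x * \<sigma> y"
    "\<And>y. y \<in> F \<Longrightarrow> \<exists>x\<in>F. \<sigma> x = y" "\<sigma> 0 = 0" "\<And>x. x \<in> F \<Longrightarrow> \<sigma> x = 0 \<longleftrightarrow> x = 0" "\<sigma> 1 = 1"
proof -
  have bij: "bij_betw \<sigma> F F" using assms by (simp add: automorphismF_def)
  show F: "\<And>x. x \<in> F \<Longrightarrow> \<sigma> x \<in> F" using bij by (auto simp: bij_betw_def)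
  show add: "\<And>x y. x \<in> F \<Longrightarrow> y \<in> F \<Longrightarrow> \<sigma> (x + y) = \<sigma> x + \<sigma> y"
    and mult: "\<And>x y. x \<in> F \<Longrightarrow> y \<in> F \<Longrightarrow> \<sigma> (x * y) = \<sigma> x * \<sigma> y"
    using assms by (simp_all add: automorphismF_def)
  show "\<exists>x\<in>F. \<sigma> x = y" if "y \<in> F" for y
    using bij that unfolding bij_betw_def by (metis imageE)
  show 0: "\<sigma> 0 = 0" using add[of 0 0] by simp
  show eq0: "\<And>x. x \<in> F \<Longrightarrow> \<sigma> x = 0 \<longleftrightarrow> x = 0"
    using bij 0 F_zero unfolding bij_betw_def inj_on_def by metis
  have "\<sigma> 1 * \<sigma> 1 = \<sigma> 1 * 1" using mult[of 1 1] by simp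
  thus "\<sigma> 1 = 1" using eq0[of 1] by (simp only: mult_cancel_left) simp
qed

text \<open>An automorphism commutes with the trace polynomial and maps only 0 to 0, and
  \<open>to_bit\<close> distinguishes just zero from nonzero.\<close>

lemma trF_automorphism:
  assumes "automorphismF m \<sigma>" "x \<in> F" shows "trF m (\<sigma> x) = trF m x"
proof -
  note \<sigma> = automorphism_props[OF assms(1)]
  have "\<sigma> (x ^ n) = \<sigma> x ^ n" for n
    by (induction n) (use \<sigma> assms(2) in auto)
  moreover have "\<sigma> (\<Sum>k\<in>A. x ^ (2 ^ k)) = (\<Sum>k\<in>A. \<sigma> (x ^ (2 ^ k)))" if "finite A" for A :: "nat set"
    using that by (induction A) (simp_all add: \<sigma> assms(2) F_sum)
  ultimately have "\<sigma> (tF x) = tF (\<sigma> x)" by (simp add: tF_def)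
  moreover have "tF x \<in> F" using assms(2) by (auto simp: tF_def intro: F_sum)
  ultimately show ?thesis using \<sigma>(6)[of "tF x"] by (simp add: trF_eq to_bit_def)
qed

text \<open>Abstracting from the matrix allows a coordinate change to be composed with the given map
  without computing products and determinants.\<close>

definition semilinear :: "('a \<Rightarrow> 'a) \<Rightarrow> ('a ^ 3 \<Rightarrow> 'a ^ 3) \<Rightarrow> bool" where
  "semilinear \<sigma> T \<longleftrightarrow> automorphismF m \<sigma> \<and>
    (\<forall>v\<in>F3. T v \<in> F3 \<and> (T v = 0 \<longrightarrow> v = 0) \<and> (\<forall>w\<in>F3. T (v + w) = T v + T w) \<and>
      (\<forall>c\<in>F. T (c *s v) = \<sigma> c *s T v))"

lemma semilinear_map_semilinear:
  assumes "\<forall>k l. A $ k $ l \<in> F" "det A \<noteq> 0" "automorphismF m \<sigma>"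
  shows "semilinear \<sigma> (semilinear_map A \<sigma>)"
  unfolding semilinear_def
proof (intro conjI ballI impI assms(3))
  note \<sigma> = automorphism_props[OF assms(3)]
  fix v :: "'a ^ 3" assume v: "v \<in> F3"
  show "semilinear_map A \<sigma> v \<in> F3"
    using assms(1) \<sigma>(1) v by (auto simp: semilinear_map_def matrix_vector_mult_def intro!: F_sum)
  show "v = 0" if "semilinear_map A \<sigma> v = 0"
  proof -
    obtain B where "B ** A = mat 1"
      using assms(2) invertible_det_nz[of A] by (auto simp: invertible_def)
    hence "(\<chi> k. \<sigma> (v $ k)) = B *v (A *v (\<chi> k. \<sigma> (v $ k)))"
      by (simp add: matrix_vector_mul_assoc)
    hence "(\<chi> k. \<sigma> (v $ k)) = 0" using that by (simp add: semilinear_map_def)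
    thus ?thesis using \<sigma>(6) v by (simp add: vec_eq_iff)
  qed
  show "semilinear_map A \<sigma> (v + w) = semilinear_map A \<sigma> v + semilinear_map A \<sigma> w" if "w \<in> F3" for w
    using v that \<sigma>(2)
    by (simp add: semilinear_map_def vec_eq_iff matrix_vector_mult_def distrib_left sum.distrib)
  show "semilinear_map A \<sigma> (c *s v) = \<sigma> c *s semilinear_map A \<sigma> v" if "c \<in> F" for c
    using v that \<sigma>(3)
    by (simp add: semilinear_map_def vec_eq_iff matrix_vector_mult_def sum_distrib_left mult_ac)
qed

lemma semilinear_image_pointT:
  assumes "semilinear \<sigma> T" "v \<in> F3" shows "T ` pointT m v = pointT m (T v)"
proof -
  have \<sigma>: "automorphismF m \<sigma>" using assms(1) by (simp add: semilinear_def)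
  have U: "\<sigma> ` {c \<in> F. c \<noteq> 0} = {c \<in> F. c \<noteq> 0}"
    using automorphism_props[OF \<sigma>] by (auto simp: image_iff) metis
  have "T ` pointT m v = (\<lambda>c. c *s T v) ` \<sigma> ` {c \<in> F. c \<noteq> 0}"
    unfolding pointT_image image_image
    by (intro image_cong refl) (use assms in \<open>auto simp: semilinear_def\<close>)
  thus ?thesis unfolding U pointT_image .
qed

lemma semilinear_compose:
  assumes "semilinear \<sigma> T"
    and "\<And>w. w \<in> F3 \<Longrightarrow> P w \<in> F3" "\<And>w. w \<in> F3 \<Longrightarrow> P w = 0 \<Longrightarrow> w = 0"
      "\<And>w w'. P (w + w') = P w + P w'" "\<And>c w. P (c *s w) = c *s P w"
  shows "semilinear \<sigma> (\<lambda>v. P (T v))"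
  unfolding semilinear_def
proof (intro conjI ballI impI)
  note T = assms(1)[unfolded semilinear_def]
  show "automorphismF m \<sigma>" using T by blast
  fix v assume v: "v \<in> F3"
  show "P (T v) \<in> F3" using T v by (intro assms(2)) blast
  show "v = 0" if "P (T v) = 0"
  proof -
    have "T v \<in> F3" "T v = 0 \<longrightarrow> v = 0" using T v by blast+
    thus ?thesis using assms(3)[of "T v"] that by blast
  qed
  show "P (T (v + w)) = P (T v) + P (T w)" if "w \<in> F3" for w
  proof -
    have "T (v + w) = T v + T w" using T v that by blast
    thus ?thesis by (simp only: assms(4))
  qed
  show "P (T (c *s v)) = \<sigma> c *s P (T v)" if "c \<in> F" for c
  proof -
    have "T (c *s v) = \<sigma> c *s T v" using T v that by blast
    thus ?thesis by (simp only: assms(5))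
  qed
qed

text \<open>A semilinear map fixing the point \<open>(0:0:1)\<close> induces a map \<open>L\<close> on the lines through it,
  that is, on K, and the linear form in its third coordinate becomes the affine summand.\<close>

lemma bool_equiv_of_semilinear:
  assumes T: "semilinear \<sigma> T" and d: "T (vector [0, 0, 1]) = vector [0, 0, d]"
    and G: "\<And>x. G x \<in> F" "G 0 = 0" and f: "\<And>x. f x = trF m (G x)" and k: "0 < k" "k \<le> q"
    and curve: "\<And>x w. w = T (vector [cX x, cY x, G x]) \<Longrightarrow> x \<noteq> 0 \<Longrightarrow> w $ 1 \<noteq> 0 \<or> w $ 2 \<noteq> 0 \<Longrightarrow>
      w $ 3 = w $ 1 ^ k * w $ 2 ^ (q - k)"
  shows "bool_equiv (\<lambda>x. trF m (hom k x)) f"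
proof -
  have \<sigma>': "automorphismF m \<sigma>" using T by (simp add: semilinear_def)
  note \<sigma> = automorphism_props[OF \<sigma>']
  have TF: "T v \<in> F3" and T0: "T v = 0 \<Longrightarrow> v = 0" if "v \<in> F3" for v
    using T that unfolding semilinear_def by blast+
  have Tadd: "T (v + w) = T v + T w" if "v \<in> F3" "w \<in> F3" for v w
    using T that unfolding semilinear_def by blast
  have Tscale: "T (c *s v) = \<sigma> c *s T v" if "v \<in> F3" "c \<in> F" for v c
    using T that unfolding semilinear_def by blast
  have e3: "vector [0, 0, 1] \<in> F3" by (simp add: forall_3)
  have dF: "d \<in> F" using TF[OF e3] unfolding d by (simp add: forall_3)
  have d0: "d \<noteq> 0"
  proof
    assume "d = 0"
    hence "T (vector [0, 0, 1]) = 0" unfolding d by (simp add: vec3_eq_iff)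
    from T0[OF e3 this] show False by (simp add: vec3_eq_iff)
  qed
  define base where "base x = T (vector [cX x, cY x, 0])" for x
  \<comment> \<open>Dividing by d normalises the coefficient of \<open>\<sigma> (G x)\<close> to
    one; the homogeneity of \<open>hom k\<close> permits this.\<close>
  define L where "L x = (base x $ 1 + base x $ 2 * i) / d" for x
  have baseF: "base x $ l \<in> F" for x l
  proof -
    have "vector [cX x, cY x, 0] \<in> F3" by (simp add: forall_3)
    from TF[OF this] show ?thesis by (simp add: base_def)
  qed
  have T_split: "T (vector [cX x, cY x, z]) = base x + \<sigma> z *s vector [0, 0, d]" if "z \<in> F" for x z
  proof -
    have "vector [cX x, cY x, z] = vector [cX x, cY x, 0] + z *s (vector [0, 0, 1] :: 'a ^ 3)"
      by (simp add: vec3_eq_iff)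
    thus ?thesis using that e3 by (simp add: Tadd Tscale base_def d forall_3)
  qed
  have base_add: "base (x + y) = base x + base y" for x y
  proof -
    have "vector [cX (x + y), cY (x + y), 0] =
        vector [cX x, cY x, 0] + (vector [cX y, cY y, 0] :: 'a ^ 3)"
      by (simp add: vec3_eq_iff cX_add cY_add)
    thus ?thesis by (simp add: base_def Tadd forall_3)
  qed
  have L_add: "L (x + y) = L x + L y" for x y
    unfolding L_def base_add vector_add_component using d0 by (simp add: field_simps)
  have L_zero: "x = 0" if "base x $ 1 = 0" "base x $ 2 = 0" for x
  proof -
    \<comment> \<open>This z cancels the third coordinate of \<open>base x\<close>, so that the
      vector (\<open>cX x\<close>, \<open>cY x\<close>, z) lies in the kernel of T.\<close>
    obtain z where z: "z \<in> F" "\<sigma> z = base x $ 3 / d" using \<sigma>(4)[of "base x $ 3 / d"] dF baseF by auto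
    have Tz: "T (vector [cX x, cY x, z]) = 0"
      unfolding T_split[OF z(1)] using z(2) that d0 by (simp add: vec3_eq_iff)
    have "vector [cX x, cY x, z] = (0 :: 'a ^ 3)"
      by (rule T0[OF _ Tz]) (use z(1) in \<open>simp add: forall_3\<close>)
    thus ?thesis using cXY_eq_0[of x] by (simp add: vec3_eq_iff)
  qed
  have "L x = 0 \<longleftrightarrow> x = 0" for x
    using L_zero[of x] L_add[of x x] d0 coords_eq_0[OF baseF baseF] by (auto simp: L_def)
  hence "inj L" by (intro injI) (metis L_add add_eq_0_iff)
  hence bij: "bij L" by (simp add: finite_UNIV_inj_surj bij_def)
  have eq: "f x = trF m (hom k (L x)) + trF m (base x $ 3 / d)" for x
  proof (cases "x = 0")
    case True
    have "L 0 = 0" "base 0 $ 3 = 0" using L_add[of 0 0] base_add[of 0 0] by auto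
    thus ?thesis using True G(2) k by (simp add: f hom_def cX_def cY_def form_def zero_power)
  next
    case False
    let ?w = "T (vector [cX x, cY x, G x])"
    have w: "?w $ 1 = base x $ 1" "?w $ 2 = base x $ 2" "?w $ 3 = base x $ 3 + \<sigma> (G x) * d"
      using T_split[OF G(1), of x x] by (simp_all add: mult.commute)
    have "L x = inverse d * (base x $ 1 + base x $ 2 * i)" by (simp add: L_def field_simps)
    hence "hom k (L x) = inverse d * hom k (base x $ 1 + base x $ 2 * i)"
      using hom_scale[of "inverse d" k] dF k(2) by simp
    also have "hom k (base x $ 1 + base x $ 2 * i) = base x $ 1 ^ k * base x $ 2 ^ (q - k)"
      by (simp add: hom_def cX_coords cY_coords baseF)
    also have "\<dots> = base x $ 3 + \<sigma> (G x) * d"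
      using curve[OF refl False] L_zero[of x] False unfolding w by metis
    also have "inverse d * \<dots> = base x $ 3 / d + \<sigma> (G x)" using d0 by (simp add: field_simps)
    finally have "trF m (hom k (L x)) = trF m (base x $ 3 / d) + trF m (\<sigma> (G x))"
      using baseF dF \<sigma>(1) G(1) by (simp add: trF_add)
    also have "trF m (\<sigma> (G x)) = f x" by (simp add: trF_automorphism[OF \<sigma>'] G(1) f)
    finally show ?thesis by (cases "trF m (base x $ 3 / d)") simp_all
  qed
  show ?thesis unfolding bool_equiv_def
  proof (intro exI conjI)
    show "bij L" by (rule bij)
    show "affine2 L" by (rule affine2I[OF L_add])
    show "affine2 (\<lambda>x. trF m (base x $ 3 / d))"
      by (rule affine2I) (simp only: base_add vector_add_component add_divide_distrib trF_add F_divide baseF dF)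
    show "f = (\<lambda>x. trF m (hom k (L x)) + trF m (base x $ 3 / d))" using eq by blast
  qed
qed

subsection \<open>Niho exponents\<close>

lemma K_pow_cong:
  fixes x :: 'a
  assumes "[a = b] (mod 2 ^ (2 * m) - 1)" "0 < a" "0 < b"
  shows "x ^ a = x ^ b"
proof (cases "x = 0")
  case False
  have "x * x ^ (2 ^ (2 * m) - 1) = x * 1" using pow_card[of x] by (simp flip: power_Suc)
  hence 1: "x ^ (2 ^ (2 * m) - 1) = 1" using False mult_left_cancel by blast
  have *: "x ^ n = x ^ (n mod M)" if "x ^ M = 1" for n M
  proof -
    have "x ^ n = x ^ (M * (n div M) + n mod M)" by (simp only: mult_div_mod_eq)
    thus ?thesis by (simp only: power_add power_mult that power_one mult_1)
  qed
  show ?thesis using *[OF 1, of a] *[OF 1, of b] assms(1) by (simp only: cong_def)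
qed (use assms(2,3) in \<open>simp add: zero_power\<close>)

lemma niho_exp_props:
  assumes "2 < q"
  shows "[2 ^ n * niho_exp m n j = (q - 1) * j + 2 ^ n] (mod 2 ^ (2 * m) - 1)" "0 < niho_exp m n j"
proof -
  let ?M = "2 ^ (2 * m) - 1 :: nat" and ?c = "(q - 1) * j + 2 ^ n"
  let ?P = "\<lambda>d. d < ?M \<and> [2 ^ n * d = ?c] (mod ?M)"
  have M: "?M = (q - 1) * (q + 1)"
  proof -
    have "2 ^ (2 * m) = q * q" by (simp add: mult_2 power_add)
    thus ?thesis by (simp add: diff_mult_distrib)
  qed
  have M0: "0 < ?M" using q_minus(2) by (simp only: M) simp
  have cop: "coprime (2 ^ n) ?M" using m_pos by (simp add: coprime_power_left_iff)
  obtain y where y: "[2 ^ n * y = 1] (mod ?M)" using cong_solve_coprime_nat[OF cop] by auto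
  have "[2 ^ n * (y * ?c) = 1 * ?c] (mod ?M)"
    unfolding mult.assoc[symmetric] by (intro cong_mult y cong_refl)
  hence "[2 ^ n * (y * ?c mod ?M) = ?c] (mod ?M)" by (simp add: cong_def mod_mult_right_eq)
  hence P: "?P (y * ?c mod ?M)" using M0 by simp
  have Pd: "?P (niho_exp m n j)" unfolding niho_exp_def
  proof (rule theI[of ?P, OF P])
    fix d assume d: "?P d"
    have "[2 ^ n * d = 2 ^ n * (y * ?c mod ?M)] (mod ?M)"
      using d P by (meson cong_sym cong_trans)
    hence "[d = y * ?c mod ?M] (mod ?M)" using cop by (simp add: cong_mult_lcancel_nat)
    thus "d = y * ?c mod ?M" using d P cong_less_modulus_unique_nat by blast
  qed
  thus "[2 ^ n * niho_exp m n j = ?c] (mod ?M)" by blast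
  \<comment> \<open>An exponent 0 would make q - 1 a divisor of 2^n, although it is odd and larger
    than 1. Positivity is what \<open>K_pow_cong\<close> requires later.\<close>
  show "0 < niho_exp m n j"
  proof (rule ccontr)
    assume "\<not> ?thesis"
    hence "[0 = ?c] (mod ?M)" using Pd by simp
    hence "?M dvd ?c" using cong_sym cong_0_iff by blast
    hence "q - 1 dvd ?c" unfolding M by (rule dvd_mult_left)
    hence "q - 1 dvd 2 ^ n" using dvd_add_right_iff[of "q - 1" "(q - 1) * j" "2 ^ n"] by simp
    moreover have "coprime (2 ^ n) (q - 1)" using m_pos by (simp add: coprime_power_left_iff)
    ultimately have "q - 1 dvd 1" using coprime_common_divisor dvd_refl by blast
    thus False using assms by simp
  qed
qed

lemma trK_add: "trK m (x + y) = trK m x + trK m (y::'a)"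
proof -
  have "z + conj z \<in> F" for z by (simp add: mem_F_iff conj_add add.commute)
  moreover have "x + y + conj (x + y) = (x + conj x) + (y + conj y)" by (simp add: conj_add ac_simps)
  ultimately show ?thesis by (simp only: trK_eq trF_add)
qed

lemma trK_pow2: "trK m (x ^ (2 ^ n)) = trK m (x::'a)"
proof -
  have "x + conj x \<in> F" by (simp add: mem_F_iff conj_add add.commute)
  moreover have "x ^ (2 ^ n) + conj (x ^ (2 ^ n)) = (x + conj x) ^ (2 ^ n)"
    by (simp add: add_pow conj_power)
  ultimately show ?thesis by (simp only: trK_eq trF_pow2)
qed

lemma trK_sum: "trK m (sum f A) = (\<Sum>j\<in>A. trK m (f j :: 'a))"
proof -
  have "trK m (0::'a) = 0" by (simp add: trK_eq)
  thus ?thesis by (induction A rule: infinite_finite_induct) (simp_all add: trK_add del: add_eq_0_iff)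
qed

lemma trF_sum: "(\<And>j. j \<in> A \<Longrightarrow> f j \<in> F) \<Longrightarrow> trF m (sum f A) = (\<Sum>j\<in>A. trF m (f j))"
  by (induction A rule: infinite_finite_induct) (simp_all add: trF_add F_sum)

text \<open>Telescoping: as v is the inverse of u, the product of u + v with u^(2j) + v^(2j) is the
  sum of u^l + v^l for l = 2j + 1 and l = 2j - 1, and neighbouring terms cancel.\<close>

lemma unitS_power_sum:
  assumes "u * v = (1::'a)"
  shows "(u + v) * (1 + (\<Sum>j = 1..<Suc n. u ^ (2 * j) + v ^ (2 * j))) = u ^ (2 * n + 1) + v ^ (2 * n + 1)"
proof (induction n)
  case (Suc n)
  have cross: "u * v ^ (2 * Suc n) = v ^ (2 * n + 1)" "v * u ^ (2 * Suc n) = u ^ (2 * n + 1)"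
    using assms by (simp_all add: mult.assoc[symmetric] mult.commute)
  have "(u + v) * (1 + (\<Sum>j = 1..<Suc (Suc n). u ^ (2 * j) + v ^ (2 * j))) =
      (u + v) * (1 + (\<Sum>j = 1..<Suc n. u ^ (2 * j) + v ^ (2 * j))) + (u + v) * (u ^ (2 * Suc n) + v ^ (2 * Suc n))"
    by (simp add: distrib_left add.assoc)
  also have "(u + v) * (u ^ (2 * Suc n) + v ^ (2 * Suc n)) =
      (u ^ (2 * Suc n + 1) + v ^ (2 * Suc n + 1)) + (u ^ (2 * n + 1) + v ^ (2 * n + 1))"
    unfolding distrib_right distrib_left cross by (simp add: ac_simps)
  finally show ?case unfolding Suc by (simp add: ac_simps)
qed simp

text \<open>The power 2^n turns u^(2^(m-n)) into the conjugate of u, that is its inverse. What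
  remains is the quotient of u^(2^n-1) + u^(1-2^n) by u + u^(-1), a geometric sum.\<close>

lemma g_niho_power:
  assumes "u \<in> unitS m" "0 < n" "n < m"
  shows "g_niho m n u ^ (2 ^ n) = 1 + (\<Sum>j = 1..<2 ^ (n - 1). u ^ (2 * j) + conj u ^ (2 * j))"
proof (cases "u = 1")
  case True
  \<comment> \<open>At u = 1 the two powers in each summand cancel, which agrees with the separately
    prescribed value 1.\<close>
  thus ?thesis by (simp add: g_niho_def)
next
  case False
  have uu: "u * conj u = 1" using assms(1) by (simp add: mem_unitS_iff)
  have Y: "u + conj u \<noteq> 0"
  proof
    assume "u + conj u = 0"
    hence "(u + 1) * (u + 1) = 0" using uu by (simp add: algebra_simps)
    thus False using False by simp
  qed
  have n: "2 * (2 ^ (n - 1) - 1) + 1 = (2 ^ n - 1 :: nat)"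
  proof -
    have "2 * 2 ^ (n - 1) = (2 ^ n :: nat)" using assms(2) by (simp flip: power_Suc)
    moreover have "1 \<le> (2::nat) ^ (n - 1)" by simp
    ultimately show ?thesis by linarith
  qed
  have Suc: "Suc (2 ^ (n - 1) - 1) = (2 ^ (n - 1) :: nat)" by simp
  have q: "(z ^ (2 ^ (m - n))) ^ (2 ^ n) = conj z" for z
    using assms(3) by (simp add: bar_def flip: power_mult power_add)
  have R: "Suc (2 ^ n - 1) = (2 ^ n :: nat)" by simp
  have a: "u ^ (2 ^ n) * conj u = u ^ (2 ^ n - 1)"
    using uu by (subst R[symmetric], subst power_Suc2) (simp add: mult.assoc)
  have b: "conj u ^ (2 ^ n) * u = conj u ^ (2 ^ n - 1)"
    using uu by (subst R[symmetric], subst power_Suc2) (simp add: mult.assoc mult.commute)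
  have "g_niho m n u ^ (2 ^ n) = (u ^ (2 ^ n) * conj u + conj u ^ (2 ^ n) * u) / (u + conj u)"
    using False by (simp add: g_niho_def power_divide add_pow power_mult_distrib q add.commute)
  also have "\<dots> = (u ^ (2 ^ n - 1) + conj u ^ (2 ^ n - 1)) / (u + conj u)" by (simp only: a b)
  also have "\<dots> = 1 + (\<Sum>j = 1..<2 ^ (n - 1). u ^ (2 * j) + conj u ^ (2 * j))"
    using unitS_power_sum[OF uu, of "2 ^ (n - 1) - 1"] Y unfolding n Suc
    by (simp only: divide_eq_eq) (simp add: mult.commute)
  finally show ?thesis .
qed

text \<open>Put Q = 2^(m-n) and X = u + Y i. Expanding X^Q Y^(q-Q) gives u^Q Y / Y^Q plus the linear
  term i^Q Y. The form with coefficient i^Q + 1 equals i^Q Y + \<open>conj u\<close>: it cancels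
  that term and adds the conjugate of u, which completes the numerator of
  \<open>g_niho\<close>.\<close>

lemma g_niho_hom:
  assumes u: "u \<in> unitS m" and n: "0 < n" "n < m"
  shows "g_niho m n u = hom (2 ^ (m - n)) u + form m (i ^ (2 ^ (m - n)) + 1) u"
proof -
  let ?Q = "2 ^ (m - n) :: nat"
  have cj: "conj (i ^ ?Q + 1) = i ^ ?Q" by (simp add: conj_add conj_power conj_i add_pow add.assoc)
  show ?thesis
  proof (cases "u = 1")
    case True
    have "(2::nat) ^ (m - n) < q" using n by simp
    moreover have "z + 1 + z = 1" for z :: 'a by (metis add.assoc add.commute add_self_left)
    ultimately show ?thesis using True
      by (simp add: g_niho_def hom_def cY_eq form_def cj zero_power)
  next
    case False
    have uu: "u * conj u = 1" using u by (simp add: mem_unitS_iff)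
    define Y where "Y = cY u"
    have Y: "Y = u + conj u" "Y \<in> F" unfolding Y_def by (rule cY_eq, rule cY_F)
    have Y0: "Y \<noteq> 0"
    proof
      assume "Y = 0"
      hence "(u + 1) * (u + 1) = 0" using uu by (simp add: Y algebra_simps)
      thus False using False by simp
    qed
    have "cX u = u + Y * i" using coords[of u] unfolding Y_def by (metis add_self_left add.commute)
    hence X: "cX u ^ ?Q = u ^ ?Q + Y ^ ?Q * i ^ ?Q" by (simp add: add_pow power_mult_distrib)
    have form: "form m (i ^ ?Q + 1) u = i ^ ?Q * Y + conj u"
      unfolding form_def cj Y by (simp add: algebra_simps)
    have QY: "Y ^ ?Q * Y ^ (q - ?Q) = Y"
      using n F_pow_q[OF Y(2)] by (simp flip: power_add)
    have "Y ^ ?Q * (hom ?Q u + form m (i ^ ?Q + 1) u) = cX u ^ ?Q * (Y ^ ?Q * Y ^ (q - ?Q)) + Y ^ ?Q * (i ^ ?Q * Y + conj u)"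
      unfolding hom_def form Y_def[symmetric] by (simp add: distrib_left mult_ac)
    also have "\<dots> = u ^ ?Q * Y + (Y ^ ?Q * i ^ ?Q * Y + Y ^ ?Q * i ^ ?Q * Y) + Y ^ ?Q * conj u"
      unfolding QY X by (simp only: distrib_left distrib_right mult_ac add_ac)
    also have "\<dots> = u ^ ?Q * (u + conj u) + (u ^ ?Q + conj u ^ ?Q) * conj u"
      by (simp add: Y add_pow)
    also have "\<dots> = u * u ^ ?Q + conj u * conj u ^ ?Q"
      by (simp add: distrib_left distrib_right mult.commute add.assoc)
    finally have "hom ?Q u + form m (i ^ ?Q + 1) u = (u * u ^ ?Q + conj u * conj u ^ ?Q) / Y ^ ?Q"
      using Y0 by (simp add: field_simps)
    thus ?thesis using False by (simp add: g_niho_def Y add_pow)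
  qed
qed

lemma g_niho_F: "u \<in> unitS m \<Longrightarrow> 0 < n \<Longrightarrow> n < m \<Longrightarrow> g_niho m n u \<in> F"
  by (simp add: g_niho_hom)

text \<open>Raising to the power 2^n inside the trace clears the factor 2^n in the congruence for
  the exponents. Since u^(q-1) = u^(-2), the j-th term at c u becomes c^(2^n) u^(2^n - 2j), and the
  whole sum is the trace of the 2^n-th power of \<open>c * g_niho m n u\<close>.\<close>

lemma f_niho_polar:
  assumes a: "a + conj a = 1" and n: "0 < n" "n < m" and q: "2 < q" and c: "c \<in> F" and u: "u \<in> unitS m"
  shows "f_niho m a n (c * u) = trF m (c * g_niho m n u)"
proof -
  let ?J = "{1..2 ^ (n - 1) - 1 :: nat}"
  have uu: "u * conj u = 1" using u by (simp add: mem_unitS_iff)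
  have half: "2 * 2 ^ (n - 1) = (2 ^ n :: nat)" using n(1) by (simp flip: power_Suc)
  have norm: "trK m (a * (c * u) ^ (q + 1)) = trF m (c ^ (2 ^ n))"
  proof -
    have "(c * u) ^ (q + 1) = (c * c) * (u * conj u)"
      using F_pow_q[OF c] by (simp add: power_mult_distrib bar_def mult_ac)
    hence eq: "(c * u) ^ (q + 1) = c ^ 2" using uu by (simp add: power2_eq_square)
    have "a * c ^ 2 + conj (a * c ^ 2) = (a + conj a) * c ^ 2"
      using c by (simp add: conj_mult conj_power conj_F distrib_right)
    hence "trK m (a * (c * u) ^ (q + 1)) = trF m (c ^ (2 ^ 1))" unfolding eq by (simp add: trK_eq a)
    thus ?thesis using trF_pow2[OF c] by (simp only:)
  qed
  have monom: "trK m ((c * u) ^ niho_exp m n j) =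
      trF m (c ^ (2 ^ n) * (u ^ (2 ^ n - 2 * j) + conj u ^ (2 ^ n - 2 * j)))" if j: "2 * j \<le> 2 ^ n" for j
  proof -
    note d = niho_exp_props[OF q, of n j]
    have "((c * u) ^ niho_exp m n j) ^ (2 ^ n) = (c * u) ^ (2 ^ n * niho_exp m n j)"
      by (simp add: mult.commute flip: power_mult)
    also have "\<dots> = (c * u) ^ ((q - 1) * j + 2 ^ n)"
      by (rule K_pow_cong[OF d(1)]) (use d(2) in auto)
    also have "\<dots> = c ^ ((q - 1) * j + 2 ^ n) * u ^ ((q - 1) * j + 2 ^ n)" by (rule power_mult_distrib)
    also have "c ^ ((q - 1) * j + 2 ^ n) = c ^ (2 ^ n)"
      by (rule F_pow_cong[OF c]) (simp_all add: cong_def)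
    also have "u ^ ((q - 1) * j + 2 ^ n) = u ^ (2 ^ n - 2 * j)"
    proof -
      have "u ^ (q - 1) = u ^ (q - 1) * (u * conj u)" by (simp add: uu)
      also have "\<dots> = u ^ Suc (q - 1) * conj u" by (simp only: power_Suc2 mult.assoc)
      also have "\<dots> = conj u ^ 2" using q_minus(1) by (simp add: bar_def power2_eq_square)
      finally have "u ^ ((q - 1) * j) = conj u ^ (2 * j)" by (simp only: power_mult)
      moreover have "u ^ (2 ^ n) = u ^ (2 * j) * u ^ (2 ^ n - 2 * j)" using j by (simp flip: power_add)
      moreover have "conj u ^ (2 * j) * u ^ (2 * j) = 1"
        using uu by (simp add: mult.commute flip: power_mult_distrib)
      ultimately show ?thesis by (simp add: power_add mult.assoc[symmetric])
    qed
    finally have "trK m ((c * u) ^ niho_exp m n j) = trK m (c ^ (2 ^ n) * u ^ (2 ^ n - 2 * j))"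
      by (metis trK_pow2)
    also have "c ^ (2 ^ n) * u ^ (2 ^ n - 2 * j) + conj (c ^ (2 ^ n) * u ^ (2 ^ n - 2 * j)) =
        c ^ (2 ^ n) * (u ^ (2 ^ n - 2 * j) + conj u ^ (2 ^ n - 2 * j))"
      using c by (simp add: conj_mult conj_power conj_F distrib_left)
    hence "trK m (c ^ (2 ^ n) * u ^ (2 ^ n - 2 * j)) =
        trF m (c ^ (2 ^ n) * (u ^ (2 ^ n - 2 * j) + conj u ^ (2 ^ n - 2 * j)))"
      by (simp only: trK_eq)
    finally show ?thesis .
  qed
  have tF: "u ^ k + conj u ^ k \<in> F" for k
    by (simp add: mem_F_iff conj_add conj_power add.commute)
  have "f_niho m a n (c * u) = trF m (c ^ (2 ^ n)) + (\<Sum>j\<in>?J. trK m ((c * u) ^ niho_exp m n j))"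
    by (simp only: f_niho_def trK_add trK_sum norm)
  also have "(\<Sum>j\<in>?J. trK m ((c * u) ^ niho_exp m n j)) =
      (\<Sum>j\<in>?J. trF m (c ^ (2 ^ n) * (u ^ (2 ^ n - 2 * j) + conj u ^ (2 ^ n - 2 * j))))"
    using half by (intro sum.cong refl monom) auto
  also have "\<dots> = (\<Sum>j = 1..<2 ^ (n - 1). trF m (c ^ (2 ^ n) * (u ^ (2 * j) + conj u ^ (2 * j))))"
  \<comment> \<open>Reversing the order of summation turns 2^n - 2j into the exponents 2j of
    \<open>g_niho_power\<close>.\<close>
  proof (rule sum.reindex_bij_witness[of _ "\<lambda>j. 2 ^ (n - 1) - j" "\<lambda>j. 2 ^ (n - 1) - j"])
    fix j assume "j \<in> ?J"
    have "2 * (2 ^ (n - 1) - j) = 2 ^ n - 2 * j" using half by (simp add: diff_mult_distrib2)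
    thus "trF m (c ^ (2 ^ n) * (u ^ (2 * (2 ^ (n - 1) - j)) + conj u ^ (2 * (2 ^ (n - 1) - j)))) =
        trF m (c ^ (2 ^ n) * (u ^ (2 ^ n - 2 * j) + conj u ^ (2 ^ n - 2 * j)))" by (simp only:)
  qed auto
  also have "\<dots> = trF m (\<Sum>j = 1..<2 ^ (n - 1). c ^ (2 ^ n) * (u ^ (2 * j) + conj u ^ (2 * j)))"
    using c tF by (intro trF_sum[symmetric]) simp
  also have "trF m (c ^ (2 ^ n)) + \<dots> =
      trF m (c ^ (2 ^ n) + (\<Sum>j = 1..<2 ^ (n - 1). c ^ (2 ^ n) * (u ^ (2 * j) + conj u ^ (2 * j))))"
    using c tF by (intro trF_add[symmetric] F_sum F_mult F_power)
  also have "c ^ (2 ^ n) + (\<Sum>j = 1..<2 ^ (n - 1). c ^ (2 ^ n) * (u ^ (2 * j) + conj u ^ (2 * j))) =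
      (c * g_niho m n u) ^ (2 ^ n)"
    unfolding power_mult_distrib g_niho_power[OF u n] by (simp only: distrib_left sum_distrib_left mult_1_right)
  also have "trF m \<dots> = trF m (c * g_niho m n u)"
    using c g_niho_F[OF u n] by (intro trF_pow2) simp
  finally show ?thesis .
qed

end

section \<open>The translation hyperoval\<close>

locale niho_translation = niho_field +
  fixes r :: nat
  assumes r_gt_1: "1 < r" and r_less: "r < m - 1" and coprime_r: "coprime r m"
begin

abbreviation e :: nat where "e \<equiv> inv_exp m r"

section \<open>Arithmetic of the third exponent\<close>

lemma q_gt_2: "2 < q"
  using power_strict_increasing[of 1 m "2::nat"] r_gt_1 r_less by simp

lemma coprime_pow2: "coprime (2 ^ j) (q - 1)"
  using m_pos by (simp add: coprime_power_left_iff)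

text \<open>The divisibility is the defining congruence with the negative factor 1 - 2^r moved
  across, which keeps it in the natural numbers.\<close>

lemma inv_exp_props: "1 \<le> e" "e \<le> q - 2" "q - 1 dvd (2 ^ r - 1) * e + 1"
proof -
  let ?P = "\<lambda>e. 1 \<le> e \<and> e \<le> 2 ^ m - 2 \<and> [(1 - 2 ^ r) * int e = 1] (mod (2 ^ m - 1))"
  have cop: "coprime (1 - 2 ^ r :: int) (2 ^ m - 1)"
  proof -
    have "coprime (int (2 ^ r - 1)) (int (2 ^ m - 1))"
      using coprime_two_power_minus_one[OF coprime_r] r_gt_1 by (simp only: coprime_int_iff)
    hence "coprime (- (2 ^ r - 1) :: int) (2 ^ m - 1)"
      by (simp add: of_nat_diff del: minus_diff_eq)
    thus ?thesis by simp
  qed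
  obtain x :: int where x: "[(1 - 2 ^ r) * x = 1] (mod (2 ^ m - 1))"
    using cong_solve_coprime_int[OF cop] by blast
  define n where "n = nat (x mod (2 ^ m - 1))"
  have q1: "(2::int) ^ m > 2" using q_gt_2 by (metis of_nat_less_iff of_nat_numeral of_nat_power)
  hence n: "int n = x mod (2 ^ m - 1)" by (simp add: n_def)
  have c: "[(1 - 2 ^ r) * int n = 1] (mod (2 ^ m - 1))"
    using x unfolding n by (simp add: cong_def mod_mult_right_eq)
  have "int n < 2 ^ m - 1" unfolding n using q1 by simp
  hence "n < q - 1" by (simp add: of_nat_diff flip: of_nat_less_iff[where 'a = int])
  moreover have "n \<noteq> 0"
  proof
    assume "n = 0"
    with c have "[0 = 1] (mod (2 ^ m - 1 :: int))" by simp
    thus False using q1 by (simp add: cong_def)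
  qed
  ultimately have P: "?P n" using c by simp
  have "?P e" unfolding inv_exp_def
  proof (rule theI[of ?P, OF P])
    fix n' assume n': "?P n'"
    have "[(1 - 2 ^ r) * int n' = (1 - 2 ^ r) * int n] (mod (2 ^ m - 1))"
      using n' P by (meson cong_sym cong_trans)
    hence "[int n' = int n] (mod (2 ^ m - 1))" using cop by (simp add: cong_mult_lcancel)
    hence "[n' = n] (mod (q - 1))" by (simp add: of_nat_diff flip: cong_int_iff)
    moreover have "n < q - 1" "n' < q - 1" using n' P q_gt_2 by linarith+
    ultimately show "n' = n" by (simp add: cong_less_modulus_unique_nat)
  qed
  thus "1 \<le> e" "e \<le> q - 2" by auto
  have "(2 ^ m - 1) dvd ((1 - 2 ^ r) * int e - 1)" using \<open>?P e\<close> by (simp add: cong_iff_dvd_diff)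
  hence "(2 ^ m - 1) dvd - ((1 - 2 ^ r) * int e - 1)" by (simp only: dvd_minus_iff)
  hence "int (q - 1) dvd int ((2 ^ r - 1) * e + 1)" by (simp add: of_nat_diff algebra_simps)
  thus "q - 1 dvd (2 ^ r - 1) * e + 1" by (simp only: of_nat_dvd_iff)
qed

lemma coprime_inv_exp: "coprime e (q - 1)"
proof (rule coprimeI)
  fix c assume "c dvd e" "c dvd q - 1"
  hence "c dvd (2 ^ r - 1) * e + 1" "c dvd (2 ^ r - 1) * e" using inv_exp_props(3) by auto
  thus "c dvd 1" using dvd_add_right_iff[of c "(2 ^ r - 1) * e" 1] by blast
qed

text \<open>Thus -e inverts the exponent 2^r - 1 on nonzero elements of F.\<close>

lemma pow_inv_exp:
  assumes "w \<in> F" "w \<noteq> 0" shows "(w ^ e) ^ (2 ^ r - 1) * w = 1"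
  using F_pow_dvd[OF assms inv_exp_props(3)] by (simp add: mult.commute flip: power_mult)

section \<open>Bentness of the three standard functions\<close>

lemma bent_pow2:
  assumes "coprime j m" "0 < j" "j < m"
  shows "bent m (\<lambda>x. trF m (hom (2 ^ j) x + form m b\<^sub>0 x))"
proof (rule bent_hom)
  fix \<alpha> \<beta> assume *: "\<alpha> \<in> F" "\<beta> \<in> F" "\<alpha> \<noteq> 0"
  show "card {t \<in> F. t ^ 2 ^ j + \<alpha> * t + \<beta> = 0} \<in> {0, 2}"
    using card_linearized[OF assms(1,2) _ *(1,2) _ *(3), of 1] by simp
qed (use assms q_gt_2 coprime_pow2 in auto)

text \<open>For nonzero t put t = w^(2^r - 1), so that t^e = 1/w. Multiplied by w, the root equation
  becomes \<alpha> w^(2^r) + \<beta> w = 1, to which \<open>card_linearized\<close> applies.\<close>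

lemma bent_inv_exp: "bent m (\<lambda>x. trF m (hom e x + form m b\<^sub>0 x))"
proof (rule bent_hom)
  fix \<alpha> \<beta> assume *: "\<alpha> \<in> F" "\<beta> \<in> F" "\<alpha> \<noteq> 0"
  let ?T = "{t \<in> F. t ^ e + \<alpha> * t + \<beta> = 0}"
  have r: "1 < (2::nat) ^ r" using r_gt_1 by (intro one_less_power) auto
  have pe: "0 < e" using inv_exp_props by simp
  have transfer: "(w ^ (2 ^ r - 1)) ^ e = inverse w" if "w \<in> F" "w \<noteq> 0" for w
    using pow_inv_exp[OF that] that(2) by (simp add: power_swap[of w _ e] field_simps)
  have eqn: "(w ^ (2 ^ r - 1)) ^ e + \<alpha> * w ^ (2 ^ r - 1) + \<beta> = 0 \<longleftrightarrow> \<alpha> * w ^ (2 ^ r) + \<beta> * w = 1"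
    if "w \<in> F" "w \<noteq> 0" for w
  proof -
    have "w ^ (2 ^ r) = w * w ^ (2 ^ r - 1)" using r by (simp flip: power_Suc)
    hence "w * ((w ^ (2 ^ r - 1)) ^ e + \<alpha> * w ^ (2 ^ r - 1) + \<beta>) =
        1 + (\<alpha> * w ^ (2 ^ r) + \<beta> * w)"
      using that(2) unfolding transfer[OF that] by (simp add: algebra_simps)
    thus ?thesis using that(2) by (metis add_eq_0_iff mult_eq_0_iff)
  qed
  let ?W = "{w \<in> F. \<alpha> * w ^ (2 ^ r) + \<beta> * w = 1}"
  have retract: "(inverse (t ^ e)) ^ (2 ^ r - 1) = t" if "t \<in> F" "t \<noteq> 0" for t
    using pow_inv_exp[OF that] that(2) by (simp add: power_inverse field_simps)
  have "bij_betw (\<lambda>w. w ^ (2 ^ r - 1)) ?W (?T - {0})"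
  proof (rule bij_betw_byWitness[where f' = "\<lambda>t. inverse (t ^ e)"])
    have W0: "w \<noteq> 0" if "w \<in> ?W" for w using that by (auto simp: zero_power)
    show "\<forall>w\<in>?W. inverse ((w ^ (2 ^ r - 1)) ^ e) = w" using transfer W0 by simp
    show "\<forall>t\<in>?T - {0}. inverse (t ^ e) ^ (2 ^ r - 1) = t" using retract by simp
    show "(\<lambda>w. w ^ (2 ^ r - 1)) ` ?W \<subseteq> ?T - {0}" using eqn W0 by auto
    show "(\<lambda>t. inverse (t ^ e)) ` (?T - {0}) \<subseteq> ?W"
    proof safe
      fix t assume t: "t \<in> F" "t ^ e + \<alpha> * t + \<beta> = 0" "t \<noteq> 0"
      show "inverse (t ^ e) \<in> F" using t by simp
      show "\<alpha> * inverse (t ^ e) ^ 2 ^ r + \<beta> * inverse (t ^ e) = 1"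
        using eqn[of "inverse (t ^ e)"] t unfolding retract[OF t(1,3)] by simp
    qed
  qed
  hence card: "card ?W = card (?T - {0})" by (rule bij_betw_same_card)
  show "card ?T \<in> {0, 2}"
  proof (cases "\<beta> = 0")
    case True
    have "?W = {w \<in> F. w ^ (2 ^ r) = 1 / \<alpha>}" using True * by (auto simp: field_simps)
    hence "card ?W = 1" using card_power_eq[OF coprime_pow2 _, of r "1 / \<alpha>"] * by simp
    \<comment> \<open>The substitution misses the root t = 0, present exactly for \<beta> = 0; it
      joins the single root that comes from w.\<close>
    moreover have "0 \<in> ?T" using True pe by (simp add: zero_power)
    ultimately show ?thesis using card card.remove[of ?T 0] by simp
  next
    case False
    have "?T - {0} = ?T" using False pe by (auto simp: zero_power)
    thus ?thesis using card card_linearized[OF coprime_r _ *(1,2) F_one *(3) False] r_gt_1 by simp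
  qed
qed (use inv_exp_props coprime_inv_exp q_gt_2 in auto)

text \<open>The complementary exponents -e and e - 1 modulo q - 1 have to be written as sums of s
  and of m - s powers of two. Since multiplication by 2^r permutes the powers of two modulo q - 1,
  geometric sums with ratio 2^r provide them.\<close>

lemma not_deg_hom_inv_exp: "\<not> deg_less m (\<lambda>x. lift_bit (trF m (hom e x)))"
proof -
  obtain x where "[r * x = 1] (mod m)" using cong_solve_coprime_nat[OF coprime_r] by auto
  hence "r * (x mod m) mod m = 1"
    using r_less by (simp add: cong_def mod_mult_right_eq)
  hence "r * (x mod m) = m * (r * (x mod m) div m) + 1" by (metis mult_div_mod_eq)
  moreover have "x mod m < m" using m_pos by simp
  ultimately obtain s y where s: "r * s = m * y + 1" "s < m" by blast
  \<comment> \<open>As r s = m y + 1, 2^(r s) is 2 modulo q - 1, so (2^r - 1)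
    \<open>E\<^sub>1\<close> is 1 and \<open>E\<^sub>1\<close> is -e. The full sum over t < m is 0
    modulo q - 1, so \<open>E\<^sub>2\<close> is e.\<close>
  define E\<^sub>1 E\<^sub>2 where "E\<^sub>1 = (\<Sum>t<s. 2 ^ (r * t) :: nat)" and "E\<^sub>2 = (\<Sum>t = s..<m. 2 ^ (r * t) :: nat)"
  have geom: "(2 ^ c - 1) * (\<Sum>t<n. 2 ^ (c * t)) + 1 = (2 ^ (c * n) :: nat)" for c n :: nat
  proof (induction n)
    case (Suc n)
    obtain b :: nat where b: "2 ^ c = b + 1" by (metis add.commute le_Suc_ex one_le_numeral one_le_power)
    show ?case using Suc b by (simp add: power_add algebra_simps)
  qed simp
  have q1_dvd: "\<exists>l. 2 ^ (m * k) = (q - 1) * l + 1" for k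
    using geom[of m k] by metis
  have cop: "coprime (q - 1) (2 ^ r - 1)"
    using coprime_two_power_minus_one[OF coprime_r] r_gt_1 by (simp add: coprime_commute)
  have 1: "q - 1 dvd e + E\<^sub>1"
  proof -
    obtain l where l: "2 ^ (m * y) = (q - 1) * l + 1" using q1_dvd by blast
    have "2 ^ (r * s) = 2 * (2 ^ (m * y) :: nat)" unfolding s(1) by simp
    hence "(2 ^ r - 1) * E\<^sub>1 + 1 = 2 * ((q - 1) * l + 1)" unfolding E\<^sub>1_def geom l by simp
    hence "(2 ^ r - 1) * (e + E\<^sub>1) = ((2 ^ r - 1) * e + 1) + (q - 1) * (2 * l)"
      unfolding distrib_left by linarith
    hence "q - 1 dvd (2 ^ r - 1) * (e + E\<^sub>1)"
      using inv_exp_props(3) by (simp only: dvd_add dvd_triv_left)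
    thus ?thesis using cop by (simp only: coprime_dvd_mult_right_iff)
  qed
  have "q - 1 dvd E\<^sub>1 + E\<^sub>2"
  proof -
    obtain l where l: "2 ^ (m * r) = (q - 1) * l + 1" using q1_dvd by blast
    have "E\<^sub>1 + E\<^sub>2 = (\<Sum>t<m. 2 ^ (r * t))"
      unfolding E\<^sub>1_def E\<^sub>2_def lessThan_atLeast0
      using s(2) by (intro sum.atLeastLessThan_concat) auto
    hence "(2 ^ r - 1) * (E\<^sub>1 + E\<^sub>2) = (q - 1) * l" using geom[of r m] l by (simp add: mult.commute)
    hence "q - 1 dvd (2 ^ r - 1) * (E\<^sub>1 + E\<^sub>2)" by simp
    thus ?thesis using cop by (simp only: coprime_dvd_mult_right_iff)
  qed
  hence "int (q - 1) dvd int (E\<^sub>1 + E\<^sub>2) - int (e + E\<^sub>1)"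
    using 1 by (intro dvd_diff) (simp_all only: of_nat_dvd_iff)
  hence "int (q - 1) dvd int E\<^sub>2 - int e" by simp
  moreover have "int (q - 1) dvd int ((2 ^ r - 1) * e + 1)"
    using inv_exp_props(3) by (simp only: of_nat_dvd_iff)
  \<comment> \<open>Modulo q - 1 the number 2^r e equals e - 1, so \<open>2 ^ r * E\<^sub>2\<close>
    is the exponent complementary to q - e.\<close>
  ultimately have "int (q - 1) dvd (int (q - 1) + 2 ^ r * (int E\<^sub>2 - int e)) + int ((2 ^ r - 1) * e + 1)"
    by (intro dvd_add dvd_refl dvd_mult)
  also have "(int (q - 1) + 2 ^ r * (int E\<^sub>2 - int e)) + int ((2 ^ r - 1) * e + 1) = int ((q - e) + 2 ^ r * E\<^sub>2)"
    using inv_exp_props(2) q_gt_2 by (simp add: of_nat_diff algebra_simps)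
  finally have 2: "q - 1 dvd (q - e) + 2 ^ r * E\<^sub>2" by (simp only: of_nat_dvd_iff)
  show ?thesis
  proof (rule hom_not_deg_less[where I = "{..<s}" and J = "{s..<m}" and \<phi> = "\<lambda>t. r * t"
        and \<psi> = "\<lambda>t. r * t + r" and A = E\<^sub>1 and B = "2 ^ r * E\<^sub>2"])
    show "q - 1 dvd e + E\<^sub>1" "q - 1 dvd (q - e) + 2 ^ r * E\<^sub>2" by (fact 1 2)+
    show "(\<Prod>t<s. x ^ 2 ^ (r * t)) = x ^ E\<^sub>1" for x :: 'a
      by (simp add: E\<^sub>1_def power_sum)
    show "(\<Prod>t = s..<m. x ^ 2 ^ (r * t + r)) = x ^ (2 ^ r * E\<^sub>2)" for x :: 'a
      by (simp add: E\<^sub>2_def power_sum sum_distrib_left power_add mult.commute)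
  qed (use inv_exp_props coprime_inv_exp q_gt_2 s in auto)
qed

text \<open>The homogenised equation y = x^(2^r) contains (0:1:0) but not (1:0:0); the second
  disjunct adjoins the latter point.\<close>

definition D_cone :: "('a ^ 3) set" where
  "D_cone = {v \<in> F3. v \<noteq> 0 \<and> (v $ 1 ^ (2 ^ r) = v $ 2 * v $ 3 ^ (2 ^ r - 1) \<or> v $ 2 = 0 \<and> v $ 3 = 0)}"

lemma two_pow_r: "2 \<le> (2::nat) ^ r" "0 < (2::nat) ^ r - 1" "Suc (2 ^ r - 1) = 2 ^ r"
  using power_increasing[of 1 r "2::nat"] r_gt_1 by auto

lemma D_cone_scale:
  assumes "v \<in> D_cone" "c \<in> F" "c \<noteq> 0" shows "c *s v \<in> D_cone"
proof -
  have "c ^ (2 ^ r) = c * c ^ (2 ^ r - 1)" using two_pow_r(3) by (simp flip: power_Suc)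
  thus ?thesis using assms by (auto simp: D_cone_def power_mult_distrib)
qed

lemma D_set_eq: "D_set m (\<lambda>t. t ^ (2 ^ r)) = pointT m ` D_cone"
proof (intro equalityI subsetI)
  fix P :: "('a ^ 3) set" assume "P \<in> D_set m (\<lambda>t. t ^ (2 ^ r))"
  then consider t where "t \<in> F" "P = pointT m (vector [t, t ^ (2 ^ r), 1])"
    | "P = pointT m (vector [1, 0, 0])" | "P = pointT m (vector [0, 1, 0])"
    by (auto simp: D_set_def)
  thus "P \<in> pointT m ` D_cone"
    using two_pow_r by cases (auto simp: D_cone_def forall_3 vec3_eq_iff zero_power)
next
  fix P assume "P \<in> pointT m ` D_cone"
  then obtain v where v: "P = pointT m v" "v \<in> D_cone" by blast
  hence vF: "v $ 1 \<in> F" "v $ 2 \<in> F" "v $ 3 \<in> F" by (auto simp: D_cone_def)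
  have P: "P = pointT m w" if "c \<in> F" "c \<noteq> 0" "v = c *s w" for c w
    using pointT_scale[OF that(1,2), of w] that(3) v(1) by simp
  show "P \<in> D_set m (\<lambda>t. t ^ (2 ^ r))"
  proof (cases "v $ 3 = 0")
    case False
    have "v $ 1 ^ (2 ^ r) = v $ 2 * v $ 3 ^ (2 ^ r - 1)" using v False by (auto simp: D_cone_def)
    moreover have "v $ 3 ^ (2 ^ r) = v $ 3 * v $ 3 ^ (2 ^ r - 1)" using two_pow_r(3) by (simp flip: power_Suc)
    ultimately have "P = pointT m (vector [v $ 1 / v $ 3, (v $ 1 / v $ 3) ^ (2 ^ r), 1])"
      using False vF by (intro P[of "v $ 3"]) (auto simp: vec3_eq_iff power_divide)
    thus ?thesis using vF by (auto simp: D_set_def)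
  next
    case True
    hence "v $ 1 = 0 \<or> v $ 2 = 0" using v two_pow_r by (auto simp: D_cone_def zero_power)
    thus ?thesis
    proof
      assume 1: "v $ 1 = 0"
      hence "v $ 2 \<noteq> 0" using v True by (auto simp: D_cone_def vec3_eq_iff)
      hence "P = pointT m (vector [0, 1, 0])"
        using 1 True vF by (intro P[of "v $ 2"]) (auto simp: vec3_eq_iff)
      thus ?thesis by (simp add: D_set_def)
    next
      assume 2: "v $ 2 = 0"
      hence "v $ 1 \<noteq> 0" using v True by (auto simp: D_cone_def vec3_eq_iff)
      hence "P = pointT m (vector [1, 0, 0])"
        using 2 True vF by (intro P[of "v $ 1"]) (auto simp: vec3_eq_iff)
      thus ?thesis by (simp add: D_set_def)
    qed
  qed
qed

lemma D_set_mem: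
  assumes "pointT m v \<in> D_set m (\<lambda>t. t ^ (2 ^ r))" shows "v \<in> D_cone"
proof -
  obtain w where w: "w \<in> D_cone" "pointT m v = pointT m w" using assms by (auto simp: D_set_eq)
  hence "v \<in> pointT m w" using pointT_self[of v] by simp
  then obtain c where "c \<in> F" "c \<noteq> 0" "v = c *s w" by (auto simp: pointT_def)
  thus ?thesis using D_cone_scale w(1) by simp
qed

text \<open>Solving the equation of the hyperoval for one coordinate, away from the point where that is the
  only nonzero coordinate, exhibits the oval with this point as nucleus as the graph of a function \<open>hom k\<close>.\<close>

lemma D_coord2:
  assumes "x \<in> F" "y \<in> F" "z \<in> F" "x \<noteq> 0 \<or> z \<noteq> 0"
  shows "x ^ (2 ^ r) = y * z ^ (2 ^ r - 1) \<or> y = 0 \<and> z = 0 \<longleftrightarrow> y = x ^ (2 ^ r) * z ^ (q - 2 ^ r)"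
proof (cases "z = 0")
  case True
  have "(2::nat) ^ r < q" using r_less by simp
  thus ?thesis using assms True two_pow_r by (auto simp: zero_power)
next
  case False
  have "(2 ^ r - 1) + (q - 2 ^ r) = q - 1"
    using power_increasing[of r m "2::nat"] r_less two_pow_r(1) by linarith
  hence "z ^ (2 ^ r - 1) * z ^ (q - 2 ^ r) = 1"
    using F_pow_minus_one[OF assms(3) False] by (simp only: power_add[symmetric])
  hence z: "z ^ (q - 2 ^ r) = inverse (z ^ (2 ^ r - 1))" by (simp add: False field_simps)
  show ?thesis unfolding z using False by (auto simp: field_simps)
qed

text \<open>On F the power 2^(m-r) inverts the power 2^r, and it takes the exponent 2^r - 1 of z to
  q - 2^(m-r).\<close>

lemma D_coord1:
  assumes "x \<in> F" "y \<in> F" "z \<in> F" "y \<noteq> 0 \<or> z \<noteq> 0"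
  shows "x ^ (2 ^ r) = y * z ^ (2 ^ r - 1) \<or> y = 0 \<and> z = 0 \<longleftrightarrow>
    x = y ^ (2 ^ (m - r)) * z ^ (q - 2 ^ (m - r))"
proof -
  have rm: "2 ^ r * 2 ^ (m - r) = q" using r_less by (simp flip: power_add)
  hence "(2 ^ r - 1) * 2 ^ (m - r) = q - 2 ^ (m - r)" by (simp add: diff_mult_distrib)
  hence z: "(z ^ (2 ^ r - 1)) ^ (2 ^ (m - r)) = z ^ (q - 2 ^ (m - r))" by (simp flip: power_mult)
  have x: "(x ^ (2 ^ r)) ^ (2 ^ (m - r)) = x" using F_pow_q[OF assms(1)] rm by (simp flip: power_mult)
  have "x ^ (2 ^ r) = y * z ^ (2 ^ r - 1) \<longleftrightarrow> x = y ^ (2 ^ (m - r)) * z ^ (q - 2 ^ (m - r))"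
    using inj_pow2[of "x ^ (2 ^ r)" "m - r" "y * z ^ (2 ^ r - 1)"]
    unfolding x power_mult_distrib z by simp
  thus ?thesis using assms(4) by auto
qed

text \<open>The exponent -e extracts the unique (2^r - 1)-th root of x^(2^r) / y; as -2^r e = 1 - e
  modulo q - 1, this root is y^e x^(q-e). If x or y is 0, both sides say z = 0.\<close>

lemma D_coord3:
  assumes "x \<in> F" "y \<in> F" "z \<in> F" "x \<noteq> 0 \<or> y \<noteq> 0"
  shows "x ^ (2 ^ r) = y * z ^ (2 ^ r - 1) \<or> y = 0 \<and> z = 0 \<longleftrightarrow> z = y ^ e * x ^ (q - e)"
proof -
  have e: "0 < e" "0 < q - e" using inv_exp_props(1,2) q_gt_2 by auto
  consider "x = 0" "y \<noteq> 0" | "x \<noteq> 0" "y = 0" | "x \<noteq> 0" "y \<noteq> 0" using assms(4) by blast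
  thus ?thesis
  proof cases
    case 3
    define w where "w = y ^ e * x ^ (q - e)"
    have "x ^ (q - e) * x ^ e = x ^ q"
      using inv_exp_props(2) q_gt_2 by (simp flip: power_add)
    hence "x ^ (q - e) * x ^ e = x" by (simp add: F_pow_q assms(1))
    hence "(x ^ (q - e)) ^ (2 ^ r - 1) * ((x ^ e) ^ (2 ^ r - 1) * x) = x ^ (2 ^ r - 1) * x"
      by (simp only: mult.assoc[symmetric] power_mult_distrib[symmetric])
    hence "(x ^ (q - e)) ^ (2 ^ r - 1) = x ^ (2 ^ r)"
      using pow_inv_exp[OF assms(1) 3(1)] two_pow_r(3) by (metis mult.right_neutral power_Suc2)
    hence w: "y * w ^ (2 ^ r - 1) = x ^ (2 ^ r)"
      using pow_inv_exp[OF assms(2) 3(2)] unfolding w_def power_mult_distrib by (simp add: mult.commute mult.left_commute)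
    have cop: "coprime (2 ^ r - 1) (q - 1)"
      using coprime_two_power_minus_one[OF coprime_r] r_gt_1 by simp
    have "x ^ (2 ^ r) = y * z ^ (2 ^ r - 1) \<longleftrightarrow> w ^ (2 ^ r - 1) = z ^ (2 ^ r - 1)"
      using 3 by (simp flip: w)
    also have "\<dots> \<longleftrightarrow> w = z"
      by (rule pow_eq_iff[OF cop two_pow_r(2)]) (use assms in \<open>auto simp: w_def\<close>)
    finally show ?thesis using 3 by (auto simp: w_def)
  qed (use e two_pow_r in \<open>auto simp: zero_power\<close>)
qed

section \<open>Classification by the position of the nucleus\<close>

abbreviation DR :: "('a ^ 3) set set" where "DR \<equiv> D_set m (\<lambda>t. t ^ (2 ^ r))"

abbreviation std :: "nat \<Rightarrow> 'a \<Rightarrow> bit" where "std k \<equiv> \<lambda>x. trF m (hom k x)"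

lemma pow2_less_q: "(2::nat) ^ r < q" "(2::nat) ^ (m - r) < q"
  using r_gt_1 r_less by simp_all

lemma coprime_diff: "coprime (m - r) m"
proof (rule coprimeI)
  fix c assume "c dvd m - r" "c dvd m"
  hence "c dvd m - (m - r)" by (rule dvd_diff_nat[rotated])
  hence "c dvd r" using r_less by simp
  thus "is_unit c" using \<open>c dvd m\<close> coprime_r coprime_common_divisor by blast
qed

text \<open>The image p of the nucleus lies on the hyperoval. In each case a coordinate change P
  brings p to (0:0:1) and places first the coordinate that carries the exponent k.\<close>

lemma niho_bent_classification:
  assumes "f \<in> niho_bent_assoc m i DR"
  obtains k where "k \<in> {e, 2 ^ (m - r), 2 ^ r}" "bool_equiv (std k) f"
proof -
  obtain g where g: "is_g_function m g f"
    and pe: "proj_equivalent m (to_triples m i (niho_hyperoval m g)) DR"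
    using assms by (auto simp: niho_bent_assoc_def)
  have gF: "g u \<in> F" if "u \<in> unitS m" for u using g that by (simp add: is_g_function_def)
  define G where "G = homogeneous_ext g"
  have Gp: "G (c * u) = c * g u" if "c \<in> F" "u \<in> unitS m" for c u
    using homogeneous_ext_polar that by (simp add: G_def)
  have one: "(1::'a) \<in> unitS m" by (simp add: mem_unitS_iff)
  have "\<exists>c u. c \<in> F \<and> u \<in> unitS m \<and> x = c * u" for x
  proof (cases "x = 0")
    case True
    thus ?thesis using one by (intro exI[of _ 0] exI[of _ 1]) simp
  next
    case False
    thus ?thesis by (rule polar) blast
  qed
  hence GF: "G x \<in> F" and f: "f x = trF m (G x)" for x
    using Gp gF g by (metis F_mult, metis is_g_function_def)
  have G0: "G 0 = 0" using Gp[OF F_zero one] by simp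
  obtain A \<sigma> where A: "\<forall>k l. A $ k $ l \<in> F" "det A \<noteq> 0" "automorphismF m \<sigma>"
    and im: "(\<lambda>P. semilinear_map A \<sigma> ` P) ` pointT m ` cone G = DR"
    using pe to_triples_hyperoval[OF gF Gp] by (auto simp: proj_equivalent_def)
  define T where "T = semilinear_map A \<sigma>"
  have T: "semilinear \<sigma> T" unfolding T_def by (rule semilinear_map_semilinear[OF A])
  have TD: "T v \<in> D_cone" if "v \<in> cone G" for v
  proof (rule D_set_mem)
    have "v \<in> F3" using that by (simp add: cone_def)
    have "T ` pointT m v \<in> DR" using im that unfolding T_def by blast
    thus "pointT m (T v) \<in> DR" by (simp only: semilinear_image_pointT[OF T \<open>v \<in> F3\<close>])
  qed
  have cone: "vector [cX x, cY x, G x] \<in> cone G" if "x \<noteq> 0" for x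
    using that cXY_eq_0[of x] GF by (auto simp: cone_def forall_3 coords vec3_eq_iff)
  define p where "p = T (vector [0, 0, 1])"
  have p: "p \<in> D_cone" unfolding p_def by (rule TD) (simp add: cone_def forall_3 vec3_eq_iff)
  hence pF: "p $ 1 \<in> F" "p $ 2 \<in> F" "p $ 3 \<in> F" by (auto simp: D_cone_def)
  have conclude: "bool_equiv (std k) f"
    if P: "\<And>w. w \<in> F3 \<Longrightarrow> P w \<in> F3" "\<And>w. w \<in> F3 \<Longrightarrow> P w = 0 \<Longrightarrow> w = 0"
        "\<And>w w'. P (w + w') = P w + P w'" "\<And>c w. P (c *s w) = c *s P w"
      and d: "P p = vector [0, 0, d]" and k: "0 < k" "k \<le> q"
      and curve: "\<And>w w'. w \<in> D_cone \<Longrightarrow> w' = P w \<Longrightarrow> w' $ 1 \<noteq> 0 \<or> w' $ 2 \<noteq> 0 \<Longrightarrow>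
        w' $ 3 = w' $ 1 ^ k * w' $ 2 ^ (q - k)" for P k d
  proof (rule bool_equiv_of_semilinear[where \<sigma> = \<sigma> and T = "\<lambda>v. P (T v)" and G = G and d = d])
    show "G x \<in> F" "G 0 = 0" "f x = trF m (G x)" "0 < k" "k \<le> q" for x by (fact GF G0 f k)+
    show "semilinear \<sigma> (\<lambda>v. P (T v))" by (rule semilinear_compose[where P = P, OF T]) (fact P)+
    show "P (T (vector [0, 0, 1])) = vector [0, 0, d]" using d by (simp only: p_def)
    show "w $ 3 = w $ 1 ^ k * w $ 2 ^ (q - k)"
      if "w = P (T (vector [cX x, cY x, G x]))" "x \<noteq> 0" "w $ 1 \<noteq> 0 \<or> w $ 2 \<noteq> 0" for x w
      by (rule curve[OF TD[OF cone[OF that(2)]] that(1,3)])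
  qed
  show ?thesis
  proof (cases "p $ 3 = 0")
    case False
    define t where "t = p $ 1 / p $ 3"
    have tF: "t \<in> F" using pF by (simp add: t_def)
    have p1: "p $ 1 = t * p $ 3" using False by (simp add: t_def)
    have z: "z ^ (2 ^ r) = z * z ^ (2 ^ r - 1)" for z :: 'a
      using two_pow_r(3) by (simp flip: power_Suc)
    have "p $ 1 ^ (2 ^ r) = p $ 2 * p $ 3 ^ (2 ^ r - 1)" using p False by (auto simp: D_cone_def)
    hence "t ^ (2 ^ r) * p $ 3 * p $ 3 ^ (2 ^ r - 1) = p $ 2 * p $ 3 ^ (2 ^ r - 1)"
      unfolding p1 power_mult_distrib z[of "p $ 3"] by (simp add: mult.assoc)
    hence p2: "p $ 2 = t ^ (2 ^ r) * p $ 3" using False by simp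
    \<comment> \<open>Since z^(2^r) is additive in z, (x,y,z) \<mapsto> (x + t z, y + t^(2^r) z, z)
      preserves the cone; in characteristic two it sends p itself to a multiple of (0,0,1). The
      first two coordinates are swapped because y carries the exponent e.\<close>
    have "bool_equiv (std e) f"
    proof (rule conclude[where P = "\<lambda>w. vector [w $ 2 + t ^ (2 ^ r) * w $ 3, w $ 1 + t * w $ 3, w $ 3]"
          and d = "p $ 3"])
      fix w w' :: "'a ^ 3" assume w: "w \<in> D_cone"
        and w': "w' = vector [w $ 2 + t ^ (2 ^ r) * w $ 3, w $ 1 + t * w $ 3, w $ 3]"
          "w' $ 1 \<noteq> 0 \<or> w' $ 2 \<noteq> 0"
      have wF: "w $ 1 \<in> F" "w $ 2 \<in> F" "w $ 3 \<in> F" using w by (auto simp: D_cone_def)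
      have "(w $ 1 + t * w $ 3) ^ (2 ^ r) = (w $ 2 + t ^ (2 ^ r) * w $ 3) * w $ 3 ^ (2 ^ r - 1)
          \<or> w $ 2 + t ^ (2 ^ r) * w $ 3 = 0 \<and> w $ 3 = 0"
        using w z[of "w $ 3"] by (auto simp: D_cone_def add_pow power_mult_distrib distrib_right)
      hence "w $ 3 = (w $ 2 + t ^ (2 ^ r) * w $ 3) ^ e * (w $ 1 + t * w $ 3) ^ (q - e)"
        by (subst (asm) D_coord3) (use wF tF w' in auto)
      thus "w' $ 3 = w' $ 1 ^ e * w' $ 2 ^ (q - e)" by (simp add: w'(1))
    qed (use tF p1 p2 inv_exp_props in \<open>auto simp: vec3_eq_iff forall_3 algebra_simps\<close>)
    thus ?thesis using that by blast
  next
    case True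
    hence p12: "p $ 1 = 0 \<or> p $ 2 = 0" using p two_pow_r by (auto simp: D_cone_def zero_power)
    show ?thesis
    proof (cases "p $ 1 = 0")
      case 1: True
      have "bool_equiv (std (2 ^ r)) f"
      proof (rule conclude[where P = "\<lambda>w. vector [w $ 1, w $ 3, w $ 2]" and d = "p $ 2"])
        fix w w' :: "'a ^ 3" assume w: "w \<in> D_cone" and w': "w' = vector [w $ 1, w $ 3, w $ 2]" "w' $ 1 \<noteq> 0 \<or> w' $ 2 \<noteq> 0"
        show "w' $ 3 = w' $ 1 ^ 2 ^ r * w' $ 2 ^ (q - 2 ^ r)"
          using D_coord2[of "w $ 1" "w $ 2" "w $ 3"] w w' by (simp add: D_cone_def)
      qed (use 1 True pow2_less_q in \<open>auto simp: vec3_eq_iff forall_3\<close>)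
      thus ?thesis using that by blast
    next
      case 2: False
      have "bool_equiv (std (2 ^ (m - r))) f"
      proof (rule conclude[where P = "\<lambda>w. vector [w $ 2, w $ 3, w $ 1]" and d = "p $ 1"])
        fix w w' :: "'a ^ 3" assume w: "w \<in> D_cone" and w': "w' = vector [w $ 2, w $ 3, w $ 1]" "w' $ 1 \<noteq> 0 \<or> w' $ 2 \<noteq> 0"
        show "w' $ 3 = w' $ 1 ^ 2 ^ (m - r) * w' $ 2 ^ (q - 2 ^ (m - r))"
          using D_coord1[of "w $ 1" "w $ 2" "w $ 3"] w w' by (simp add: D_cone_def)
      qed (use 2 p12 True pow2_less_q in \<open>auto simp: vec3_eq_iff forall_3\<close>)
      thus ?thesis using that by blast
    qed
  qed
qed

text \<open>An injective map of the finite set \<open>F3\<close> into itself is onto, so the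
  equivalence of memberships makes the image of the cone all of \<open>D_cone\<close>.\<close>

lemma proj_equivalent_cone:
  assumes A: "\<forall>k l. A $ k $ l \<in> F" "det A \<noteq> 0"
    and cone: "\<And>v. v \<in> F3 \<Longrightarrow> v \<noteq> 0 \<Longrightarrow> v \<in> cone G \<longleftrightarrow> A *v v \<in> D_cone"
  shows "proj_equivalent m (pointT m ` cone G) DR"
proof -
  have id: "automorphismF m (\<lambda>x. x)" by (simp add: automorphismF_def bij_betw_def)
  define T where "T = semilinear_map A (\<lambda>x. x)"
  have T_eq: "T v = A *v v" for v by (simp add: T_def semilinear_map_def)
  have T: "semilinear (\<lambda>x. x) T" unfolding T_def by (rule semilinear_map_semilinear[OF A id])
  have TF: "T v \<in> F3" and T0: "T v = 0 \<Longrightarrow> v = 0" if "v \<in> F3" for v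
    using T that unfolding semilinear_def by blast+
  have "inj_on T F3"
  proof (rule inj_onI)
    fix v w assume "v \<in> F3" "w \<in> F3" "T v = T w"
    hence "T (v - w) = 0" by (simp add: T_eq matrix_vector_mult_diff_distrib del: minus_eq)
    moreover have "v - w \<in> F3" using \<open>v \<in> F3\<close> \<open>w \<in> F3\<close> by simp
    ultimately show "v = w" using T0[of "v - w"] by simp
  qed
  hence surj: "T ` F3 = F3" using TF by (intro endo_inj_surj) auto
  have "T ` cone G = D_cone"
  proof (intro equalityI subsetI)
    fix w assume "w \<in> T ` cone G"
    thus "w \<in> D_cone" using cone by (auto simp: T_eq cone_def)
  next
    fix w assume w: "w \<in> D_cone"
    hence "w \<in> F3" "w \<noteq> 0" by (auto simp: D_cone_def)
    then obtain v where v: "v \<in> F3" "w = T v" using surj by blast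
    moreover have "v \<noteq> 0" using v \<open>w \<noteq> 0\<close> by (auto simp: T_eq)
    ultimately show "w \<in> T ` cone G" using cone w by (auto simp: T_eq)
  qed
  moreover have "(\<lambda>P. T ` P) ` pointT m ` cone G = pointT m ` T ` cone G"
    unfolding image_image
    by (intro image_cong refl semilinear_image_pointT[OF T]) (simp add: cone_def)
  ultimately have "(\<lambda>P. T ` P) ` pointT m ` cone G = DR" by (simp add: D_set_eq)
  moreover have "pointT m ` cone G \<subseteq> PG2 m" "DR \<subseteq> PG2 m"
    unfolding D_set_eq PG2_def by (auto simp: cone_def D_cone_def)
  ultimately show ?thesis unfolding proj_equivalent_def T_def using A id by blast
qed

lemma D_cone_iff:
  assumes "v \<in> F3" "v \<noteq> 0"
  shows "v \<in> D_cone \<longleftrightarrow> v $ 1 ^ (2 ^ r) = v $ 2 * v $ 3 ^ (2 ^ r - 1) \<or> v $ 2 = 0 \<and> v $ 3 = 0"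
  using assms unfolding D_cone_def by blast

text \<open>In each matrix the row (\<alpha>, \<beta>, 1) removes the linear summand from the third
  coordinate, and the unit rows arrange the coordinates so that the solved equation for this k
  applies.\<close>

lemma proj_equivalent_std:
  assumes k: "k \<in> {e, 2 ^ (m - r), 2 ^ r}"
    and G: "\<And>x. G x = hom k x + form m b x"
  shows "proj_equivalent m (pointT m ` cone G) DR"
proof -
  define \<alpha> \<beta> where "\<alpha> = form m b 1" and "\<beta> = form m b i"
  have ab: "\<alpha> \<in> F" "\<beta> \<in> F" by (simp_all add: \<alpha>_def \<beta>_def)
  have cone_iff: "v \<in> cone G \<longleftrightarrow> v $ 1 = 0 \<and> v $ 2 = 0 \<or>
      v $ 3 + \<alpha> * v $ 1 + \<beta> * v $ 2 = v $ 1 ^ k * v $ 2 ^ (q - k)" if "v \<in> F3" "v \<noteq> 0" for v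
  proof -
    have vF: "v $ 1 \<in> F" "v $ 2 \<in> F" using that by auto
    have "form m b x = \<alpha> * cX x + \<beta> * cY x" for x
      unfolding \<alpha>_def \<beta>_def by (rule form_coords)
    hence "G (v $ 1 + v $ 2 * i) = v $ 1 ^ k * v $ 2 ^ (q - k) + (\<alpha> * v $ 1 + \<beta> * v $ 2)"
      by (simp only: G hom_def cX_coords[OF vF] cY_coords[OF vF])
    moreover have "z = s + t \<longleftrightarrow> z + t = s" for z s t :: 'a by (metis add_self_left add.commute)
    ultimately have "v $ 3 = G (v $ 1 + v $ 2 * i) \<longleftrightarrow>
        v $ 3 + (\<alpha> * v $ 1 + \<beta> * v $ 2) = v $ 1 ^ k * v $ 2 ^ (q - k)"
      by metis
    thus ?thesis using that unfolding cone_def mem_Collect_eq coords_eq_0[OF vF] add.assoc by blast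
  qed
  from k consider "k = e" | "k = 2 ^ (m - r)" | "k = 2 ^ r" by blast
  thus ?thesis
  proof cases
    case 1
    let ?A = "vector [vector [0, 1, 0], vector [1, 0, 0], vector [\<alpha>, \<beta>, 1]] :: 'a ^ 3 ^ 3"
    show ?thesis
    proof (rule proj_equivalent_cone)
      fix v assume v: "v \<in> F3" "v \<noteq> (0 :: 'a ^ 3)"
      let ?w = "?A *v v"
      have w: "?w $ 1 = v $ 2" "?w $ 2 = v $ 1" "?w $ 3 = v $ 3 + \<alpha> * v $ 1 + \<beta> * v $ 2"
        by (simp_all add: matrix_vector_mult_def sum_3 ac_simps)
      have "?w \<in> F3" "?w \<noteq> 0" using v ab by (auto simp: forall_3 w vec3_eq_iff)
      thus "v \<in> cone G \<longleftrightarrow> ?w \<in> D_cone"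
        using D_coord3[of "?w $ 1" "?w $ 2" "?w $ 3"] two_pow_r v ab
        unfolding D_cone_iff[OF \<open>?w \<in> F3\<close> \<open>?w \<noteq> 0\<close>] cone_iff[OF v] w 1
        by (cases "v $ 1 = 0 \<and> v $ 2 = 0") (auto simp: zero_power)
    qed (use ab in \<open>auto simp: forall_3 det_3\<close>)
  next
    case 2
    let ?A = "vector [vector [\<alpha>, \<beta>, 1], vector [1, 0, 0], vector [0, 1, 0]] :: 'a ^ 3 ^ 3"
    show ?thesis
    proof (rule proj_equivalent_cone)
      fix v assume v: "v \<in> F3" "v \<noteq> (0 :: 'a ^ 3)"
      let ?w = "?A *v v"
      have w: "?w $ 2 = v $ 1" "?w $ 3 = v $ 2" "?w $ 1 = v $ 3 + \<alpha> * v $ 1 + \<beta> * v $ 2"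
        by (simp_all add: matrix_vector_mult_def sum_3 ac_simps)
      have "?w \<in> F3" "?w \<noteq> 0" using v ab by (auto simp: forall_3 w vec3_eq_iff)
      thus "v \<in> cone G \<longleftrightarrow> ?w \<in> D_cone"
        using D_coord1[of "?w $ 1" "?w $ 2" "?w $ 3"] two_pow_r v ab
        unfolding D_cone_iff[OF \<open>?w \<in> F3\<close> \<open>?w \<noteq> 0\<close>] cone_iff[OF v] w 2
        by (cases "v $ 1 = 0 \<and> v $ 2 = 0") (auto simp: zero_power)
    qed (use ab in \<open>auto simp: forall_3 det_3\<close>)
  next
    case 3
    let ?A = "vector [vector [1, 0, 0], vector [\<alpha>, \<beta>, 1], vector [0, 1, 0]] :: 'a ^ 3 ^ 3"
    show ?thesis
    proof (rule proj_equivalent_cone)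
      fix v assume v: "v \<in> F3" "v \<noteq> (0 :: 'a ^ 3)"
      let ?w = "?A *v v"
      have w: "?w $ 1 = v $ 1" "?w $ 3 = v $ 2" "?w $ 2 = v $ 3 + \<alpha> * v $ 1 + \<beta> * v $ 2"
        by (simp_all add: matrix_vector_mult_def sum_3 ac_simps)
      have "?w \<in> F3" "?w \<noteq> 0" using v ab by (auto simp: forall_3 w vec3_eq_iff)
      thus "v \<in> cone G \<longleftrightarrow> ?w \<in> D_cone"
        using D_coord2[of "?w $ 1" "?w $ 2" "?w $ 3"] two_pow_r v ab
        unfolding D_cone_iff[OF \<open>?w \<in> F3\<close> \<open>?w \<noteq> 0\<close>] cone_iff[OF v] w 3
        by (cases "v $ 1 = 0 \<and> v $ 2 = 0") (auto simp: zero_power)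
    qed (use ab in \<open>auto simp: forall_3 det_3\<close>)
  qed
qed

text \<open>Adding a linear form to a standard function preserves bentness, the projective class of
  the hyperoval and the equivalence class; this treats all three representatives at once.\<close>

lemma std_shift_assoc:
  assumes k: "k \<in> {e, 2 ^ (m - r), 2 ^ r}"
    and f: "\<And>c u. c \<in> F \<Longrightarrow> u \<in> unitS m \<Longrightarrow> f (c * u) = trF m (c * g u)"
    and g: "\<And>u. u \<in> unitS m \<Longrightarrow> g u = hom k u + form m b u"
  shows "is_g_function m g f" "f \<in> niho_bent_assoc m i DR" "bool_equiv (std k) f"
proof -
  have kq: "k \<le> q" using k inv_exp_props pow2_less_q by auto
  define G where "G x = hom k x + form m b x" for x
  have gF: "g u \<in> F" if "u \<in> unitS m" for u using g that by simp
  show gf: "is_g_function m g f" using gF f by (simp add: is_g_function_def)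
  have Gp: "G (c * u) = c * g u" if "c \<in> F" "u \<in> unitS m" for c u
    using that kq by (simp add: G_def g hom_scale form_scale distrib_left)
  have "f x = trF m (G x)" for x
  proof (cases "x = 0")
    case True
    have "(1::'a) \<in> unitS m" by (simp add: mem_unitS_iff)
    thus ?thesis using True f[of 0 1] Gp[of 0 1] by simp
  next
    case False
    thus ?thesis by (rule polar) (simp add: f Gp)
  qed
  hence f_eq: "f = (\<lambda>x. trF m (hom k x + form m b x))" by (simp add: fun_eq_iff G_def)
  have "bent m f"
    using k bent_inv_exp[of b] bent_pow2[of r b] bent_pow2[of "m - r" b] coprime_r coprime_diff r_gt_1 r_less
    unfolding f_eq by auto
  moreover have "proj_equivalent m (to_triples m i (niho_hyperoval m g)) DR"
    using proj_equivalent_std[OF k G_def] to_triples_hyperoval[OF gF Gp] by simp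
  ultimately show "f \<in> niho_bent_assoc m i DR" using gf by (auto simp: niho_bent_assoc_def)
  have "affine2 (\<lambda>x. trF m (form m b x))"
    by (rule affine2I) (simp only: form_add trF_add form_in_F)
  moreover have "affine2 (\<lambda>x::'a. x)" "bij (\<lambda>x::'a. x)"
    by (rule affine2I, rule refl) (simp add: bij_def inj_def)
  ultimately show "bool_equiv (std k) f" unfolding bool_equiv_def f_eq
    by (intro exI[of _ "\<lambda>x. x"] exI[of _ "\<lambda>x. trF m (form m b x)"]) (simp add: trF_add)
qed

text \<open>The threshold m separates e from both powers of two, and the threshold m - j + 1
  separates 2^j from 2^l whenever j < l.\<close>

lemma std_inequivalent:
  "\<not> bool_equiv (std e) (std (2 ^ (m - r)))" "\<not> bool_equiv (std e) (std (2 ^ r))"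
  "\<not> bool_equiv (std (2 ^ (m - r))) (std (2 ^ r))"
proof -
  have inv: "deg_less d (\<lambda>x. lift_bit (std l x)) \<longleftrightarrow> deg_less d (\<lambda>x. lift_bit (std l' x))"
    if "bool_equiv (std l) (std l')" "2 \<le> d" for l l' d
    using deg_less_bool_equiv that bool_equiv_sym by blast
  have e_pow2: False if "bool_equiv (std e) (std (2 ^ j))" "1 < j" "j < m" for j
  proof -
    have "deg_less m (\<lambda>x. lift_bit (std (2 ^ j) x))"
      \<comment> \<open>Here 1 < j is essential: it gives m - j + 2 \<le> m.\<close>
      by (rule deg_less_mono[OF _ deg_hom_pow2]) (use that in auto)
    thus False using inv[OF that(1), of m] not_deg_hom_inv_exp that by linarith
  qed
  have pow2_pow2: "\<not> j < l" if "bool_equiv (std (2 ^ j)) (std (2 ^ l))" "0 < j" "l < m" for j l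
  proof
    assume "j < l"
    have "deg_less (m - j + 1) (\<lambda>x. lift_bit (std (2 ^ l) x))"
      by (rule deg_less_mono[OF _ deg_hom_pow2]) (use that \<open>j < l\<close> in auto)
    moreover have "\<not> deg_less (m - j + 1) (\<lambda>x. lift_bit (std (2 ^ j) x))"
      by (rule not_deg_hom_pow2) (use that \<open>j < l\<close> in auto)
    ultimately show False using inv[OF that(1), of "m - j + 1"] that \<open>j < l\<close> by simp
  qed
  have ne: "m - r \<noteq> r"
  proof
    assume "m - r = r"
    hence "m = 2 * r" using r_less by simp
    hence "r dvd m" by simp
    thus False using coprime_r r_gt_1 coprime_absorb_left by (metis nat_less_le nat_dvd_1_iff_1)
  qed
  have rr: "1 < r" "r < m" "1 < m - r" "m - r < m" using r_gt_1 r_less by auto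
  show "\<not> bool_equiv (std e) (std (2 ^ (m - r)))" "\<not> bool_equiv (std e) (std (2 ^ r))"
    using e_pow2 rr by blast+
  show "\<not> bool_equiv (std (2 ^ (m - r))) (std (2 ^ r))"
  proof
    assume *: "bool_equiv (std (2 ^ (m - r))) (std (2 ^ r))"
    show False using pow2_pow2[OF *] pow2_pow2[OF bool_equiv_sym[OF *]] rr ne by linarith
  qed
qed

end

section \<open>The quotient and its three representatives\<close>

theorem theorem4p3:
  fixes a i :: "'a::{field,finite}" and m r :: nat
    and N :: "('a \<Rightarrow> bit) set" and R :: "(('a \<Rightarrow> bit) \<times> ('a \<Rightarrow> bit)) set"
  assumes "CARD('a) = 2 ^ (2 * m)"
    and "m \<ge> 5" and "1 < r" and "r < m - 1" and "coprime r m"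
    and "i + bar m i = 1" and "a + bar m a = 1"
    and N: "N = niho_bent_assoc m i (D_set m (\<lambda>t. t ^ (2 ^ r)))"
    and R: "R = bool_equiv_on N"
  shows "card (N // R) = 3 \<and>
    {f_niho m a r, f_niho m a (m - r), f_third m i r} \<subseteq> N \<and>
    N // R = {R `` {f_niho m a r}, R `` {f_niho m a (m - r)}, R `` {f_third m i r}} \<and>
    is_g_function m (g_niho m r) (f_niho m a r) \<and>
    is_g_function m (g_niho m (m - r)) (f_niho m a (m - r)) \<and>
    is_g_function m (g_third m i r) (f_third m i r)"
proof -
  interpret niho_translation m i r
    by standard (use assms in auto)
  have mr: "0 < r" "r < m" "0 < m - r" "m - r < m" "m - (m - r) = r" using assms by auto
  have third: "f_third m i r (c * u) = trF m (c * g_third m i r u)" if "c \<in> F" for c u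
    using hom_scale[OF that, of e] inv_exp_props(2)
    by (simp add: f_third_def g_third_def hom_def cX_def cY_def)
  have third_hom: "g_third m i r u = hom e u + form m 0 u" for u
    by (simp add: g_third_def hom_def cX_def cY_def form_def)
  let ?Q = "2 ^ (m - r) :: nat" and ?f\<^sub>1 = "f_niho m a r" and ?f\<^sub>2 = "f_niho m a (m - r)" and ?f\<^sub>3 = "f_third m i r"
  \<comment> \<open>The exponents cross over: \<open>g_niho_hom\<close> attaches 2^(m-r) to the
    function with parameter r, and 2^r to the one with parameter m - r.\<close>
  note rep1 = std_shift_assoc[where k = "2 ^ (m - r)" and f = ?f\<^sub>1 and g = "g_niho m r"
      and b = "i ^ (2 ^ (m - r)) + 1",
      OF _ f_niho_polar[OF assms(7) mr(1,2) q_gt_2] g_niho_hom[OF _ mr(1,2)], simplified]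
  note rep2 = std_shift_assoc[where k = "2 ^ r" and f = ?f\<^sub>2 and g = "g_niho m (m - r)"
      and b = "i ^ (2 ^ r) + 1",
      OF _ f_niho_polar[OF assms(7) mr(3,4) q_gt_2] g_niho_hom[OF _ mr(3,4), unfolded mr(5)], simplified]
  note rep3 = std_shift_assoc[where k = e and f = ?f\<^sub>3 and g = "g_third m i r" and b = 0,
      OF _ third third_hom, simplified]
  have reps: "?f\<^sub>1 \<in> N" "?f\<^sub>2 \<in> N" "?f\<^sub>3 \<in> N" unfolding N by (fact rep1(2) rep2(2) rep3(2))+
  have cover: "\<exists>h\<in>{?f\<^sub>1, ?f\<^sub>2, ?f\<^sub>3}. bool_equiv h f" if f: "f \<in> N" for f
  proof -
    obtain k where "k \<in> {e, 2 ^ (m - r), 2 ^ r}" "bool_equiv (std k) f"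
      using niho_bent_classification[OF f[unfolded N]] .
    thus ?thesis using rep1(3) rep2(3) rep3(3) bool_equiv_sym bool_equiv_trans by blast
  qed
  have neq: "\<not> bool_equiv ?f\<^sub>1 ?f\<^sub>2" "\<not> bool_equiv ?f\<^sub>1 ?f\<^sub>3" "\<not> bool_equiv ?f\<^sub>2 ?f\<^sub>3"
    using std_inequivalent rep1(3) rep2(3) rep3(3) bool_equiv_sym bool_equiv_trans by blast+
  have class_eq: "R `` {f} = R `` {h} \<longleftrightarrow> bool_equiv f h" if "f \<in> N" "h \<in> N" for f h
  proof
    assume "R `` {f} = R `` {h}"
    moreover have "h \<in> R `` {h}" using that bool_equiv_refl by (auto simp: R bool_equiv_on_def)
    ultimately show "bool_equiv f h" by (auto simp: R bool_equiv_on_def)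
  next
    assume "bool_equiv f h"
    thus "R `` {f} = R `` {h}"
      using that bool_equiv_sym bool_equiv_trans unfolding R bool_equiv_on_def by blast
  qed
  have quotient: "N // R = {R `` {?f\<^sub>1}, R `` {?f\<^sub>2}, R `` {?f\<^sub>3}}"
  proof (intro equalityI subsetI)
    fix C assume "C \<in> N // R"
    then obtain f where f: "f \<in> N" "C = R `` {f}" by (auto simp: quotient_def)
    thus "C \<in> {R `` {?f\<^sub>1}, R `` {?f\<^sub>2}, R `` {?f\<^sub>3}}"
      using cover[OF f(1)] class_eq[OF _ f(1)] reps by blast
  qed (use reps in \<open>auto simp: quotient_def\<close>)
  moreover have "card {R `` {?f\<^sub>1}, R `` {?f\<^sub>2}, R `` {?f\<^sub>3}} = 3"
    using neq by (simp add: class_eq reps)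
  ultimately show ?thesis using reps rep1(1) rep2(1) rep3(1) by simp
qed

end
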